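(* Let $\delta>0$ and let $\mathcal{M}$ be an infinite set of positive integers. For each $N\in\mathcal{M}$ let $r=r_N$ be an integer with $1\le r\le N^{1-\delta}$, let $v_k=(\tau_k,\omega_k)$, $k=1,\dots,r$, be distinct points of $\mathbb{Z}_N\times\mathbb{Z}_N$ (the targets), let $S=S_N\in\mathcal{H}=\mathbb{C}(\mathbb{Z}_N)$ be a norm-one $1$-pseudo-random sequence, and let $$R[n]=\sum_{k=1}^{r}\alpha_k\, e(\omega_k n)\,S[n-\tau_k]+\mathcal{W}[n],\qquad n\in\mathbb{Z}_N,$$ where the random vector $\vec\alpha=(\alpha_1,\dots,\alpha_r)$ of attenuation coefficients, with values in $S_{\mathbb{C}}^{r-1}$, and the random noise $\mathcal{W}$, with values in $\mathcal{H}$, satisfy the uniformity, square root cancellation and independence assumptions. Let $P_D$ and $E_{FT}$ be the probability of detection and the expected number of false targets of the pseudo-random (PR) method with parameter $\delta/4$ applied to $S$ and $R$. Then $$P_D\to 1\quad\text{and}\quad E_{FT}\to 0\qquad\text{as } N\to\infty,\ N\in\mathcal{M}.$$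
   Context: Notation: $\mathbb{Z}_N=\{0,1,\dots,N-1\}$ with arithmetic modulo $N$; $\mathcal{H}=\mathbb{C}(\mathbb{Z}_N)$ is the space of complex-valued functions on $\mathbb{Z}_N$ with the standard inner product $\langle\cdot,\cdot\rangle$; $e(t)=\exp(2\pi i t/N)$; $S_{\mathbb{C}}^{m-1}=\{z\in\mathbb{C}^m: \sum_{k=1}^m|z_k|^2=1\}$; $S_{\mathbb{C}}^{N-1}$ is identified with the unit sphere of $\mathcal{H}$. Put $V=\mathbb{Z}_N\times\mathbb{Z}_N$. Time-frequency shifts and ambiguity function: for $(\tau,\omega)\in V$ and $f\in\mathcal{H}$, $[\pi(\tau,\omega)f][n]=e(\omega n)f[n-\tau]$. For $f,g\in\mathcal{H}$, $\mathcal{A}(f,g)[\tau,\omega]=\langle\pi(\tau,\omega)f,g\rangle$. Pseudo-random sequence: for $B\in\mathbb{R}$, a norm-one $\varphi\in\mathcal{H}$ is $B$-pseudo-random if $|\mathcal{A}(\varphi,\varphi)[\tau,\omega]|\le B/\sqrt{N}$ for every $(\tau,\omega)\ne(0,0)$. PR method with parameter $\delta'>0$: given $S$ and $R$, it returns (detects) exactly those $v\in V$ at which $|\mathcal{A}(S,R)[v]|\ge N^{-1/2+\delta'}$. Assumptions ($P$ denotes the probability measure on the sample space $\boldsymbol{\Omega}$ carrying $\vec\alpha$ and $\mathcal{W}$ for the given $N$): - Square root cancellation: for every $\varepsilon>0$ there exists $c>0$ (independent of $N$) such that for all $N$ and any $N^2$ vectors $u_1,\dots,u_{N^2}\in S_{\mathbb{C}}^{N-1}$,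 $P\big(|\langle\mathcal{W},u_j\rangle|\le N^{-1/2+\varepsilon},\ j=1,\dots,N^2\big)\ge 1-e^{-cN}$. - Uniformity: $\vec\alpha$ is distributed according to the rotation-invariant (i.e. $U(r)$-invariant, normalized surface) Borel probability measure on $S_{\mathbb{C}}^{r-1}$. - Independence: $\mathcal{W}$ and $\vec\alpha$ are independent. Performance: for $\boldsymbol{\omega}\in\boldsymbol{\Omega}$, let $\mathcal{N}_t(\boldsymbol{\omega})$ be the number of returned points lying in $\{v_1,\dots,v_r\}$ (true targets detected) and $\mathcal{N}_f(\boldsymbol{\omega})$ the number of returned points in $V\setminus\{v_1,\dots,v_r\}$ (false targets detected). Then $P_D=\frac1r\int_{\boldsymbol{\Omega}}\mathcal{N}_t\,dP$ and $E_{FT}=\int_{\boldsymbol{\Omega}}\mathcal{N}_f\,dP$. *)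

theory Defs
  imports "HOL-Probability.Probability"
begin

section \<open>Signals on the integers modulo \<open>N\<close>\<close>

text \<open>
  Residues are represented by integers in \<open>{0..<N}\<close>. A complex vector indexed by a finite set
  \<open>I\<close> is an element of \<open>I \<rightarrow>\<^sub>E UNIV\<close> (a function that is \<open>undefined\<close> outside \<open>I\<close>); in particular
  \<open>Zmod N \<rightarrow>\<^sub>E UNIV\<close> is the space of complex-valued functions on the residues modulo \<open>N\<close>.
\<close>

definition Zmod :: "nat \<Rightarrow> int set" where
  "Zmod N = {0..<int N}"

definition Vmod :: "nat \<Rightarrow> (int \<times> int) set" where
  "Vmod N = Zmod N \<times> Zmod N"

definition echar :: "nat \<Rightarrow> int \<Rightarrow> complex" where
  "echar N t = exp (2 * complex_of_real pi * \<i> * of_int t / of_nat N)"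

definition cinner :: "'i set \<Rightarrow> ('i \<Rightarrow> complex) \<Rightarrow> ('i \<Rightarrow> complex) \<Rightarrow> complex" where
  "cinner I f g = (\<Sum>i\<in>I. f i * cnj (g i))"

definition csphere :: "'i set \<Rightarrow> ('i \<Rightarrow> complex) set" where
  "csphere I = {z \<in> I \<rightarrow>\<^sub>E UNIV. (\<Sum>i\<in>I. (cmod (z i))\<^sup>2) = 1}"

definition tf_shift :: "nat \<Rightarrow> int \<times> int \<Rightarrow> (int \<Rightarrow> complex) \<Rightarrow> int \<Rightarrow> complex" where
  "tf_shift N = (\<lambda>(\<tau>, \<omega>) f. \<lambda>n\<in>Zmod N. echar N (\<omega> * n) * f ((n - \<tau>) mod int N))"

definition ambiguity :: "nat \<Rightarrow> (int \<Rightarrow> complex) \<Rightarrow> (int \<Rightarrow> complex) \<Rightarrow> int \<times> int \<Rightarrow> complex" where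
  "ambiguity N f g v = cinner (Zmod N) (tf_shift N v f) g"

definition pseudo_random :: "nat \<Rightarrow> real \<Rightarrow> (int \<Rightarrow> complex) \<Rightarrow> bool" where
  "pseudo_random N B \<phi> \<longleftrightarrow>
     \<phi> \<in> csphere (Zmod N) \<and>
     (\<forall>v \<in> Vmod N - {(0, 0)}. cmod (ambiguity N \<phi> \<phi> v) \<le> B / sqrt (real N))"


section \<open>The received signal and the pseudo-random method\<close>

definition received ::
  "nat \<Rightarrow> nat \<Rightarrow> (nat \<Rightarrow> int \<times> int) \<Rightarrow> (int \<Rightarrow> complex) \<Rightarrow> (nat \<Rightarrow> complex) \<Rightarrow> (int \<Rightarrow> complex)
     \<Rightarrow> int \<Rightarrow> complex" where
  "received N r v S a w =
     (\<lambda>n\<in>Zmod N. (\<Sum>k = 1..r. a k * echar N (snd (v k) * n) * S ((n - fst (v k)) mod int N)) + w n)"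

definition PR_method ::
  "nat \<Rightarrow> real \<Rightarrow> (int \<Rightarrow> complex) \<Rightarrow> (int \<Rightarrow> complex) \<Rightarrow> (int \<times> int) set" where
  "PR_method N \<delta>' S R = {v \<in> Vmod N. cmod (ambiguity N S R v) \<ge> real N powr (- 1 / 2 + \<delta>')}"

text \<open>In the following two definitions \<open>R\<close> is the random received signal on the probability
  space \<open>P\<close>, and \<open>v 1, \<dots>, v r\<close> are the true targets.\<close>

definition detection_prob ::
  "nat \<Rightarrow> real \<Rightarrow> nat \<Rightarrow> (nat \<Rightarrow> int \<times> int) \<Rightarrow> (int \<Rightarrow> complex) \<Rightarrow> 'w measure
     \<Rightarrow> ('w \<Rightarrow> int \<Rightarrow> complex) \<Rightarrow> real" where
  "detection_prob N \<delta>' r v S P R =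
     1 / real r * (\<integral>x. real (card (PR_method N \<delta>' S (R x) \<inter> v ` {1..r})) \<partial>P)"

definition expected_false_targets ::
  "nat \<Rightarrow> real \<Rightarrow> nat \<Rightarrow> (nat \<Rightarrow> int \<times> int) \<Rightarrow> (int \<Rightarrow> complex) \<Rightarrow> 'w measure
     \<Rightarrow> ('w \<Rightarrow> int \<Rightarrow> complex) \<Rightarrow> real" where
  "expected_false_targets N \<delta>' r v S P R =
     (\<integral>x. real (card (PR_method N \<delta>' S (R x) \<inter> (Vmod N - v ` {1..r}))) \<partial>P)"


section \<open>Assumptions on noise and attenuation coefficients\<close>

text \<open>For finite \<open>I\<close> the product sigma-algebra is the Borel sigma-algebra of the complex vectors
  indexed by \<open>I\<close>.\<close>

abbreviation cvec_borel :: "'i set \<Rightarrow> ('i \<Rightarrow> complex) measure" where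
  "cvec_borel I \<equiv> PiM I (\<lambda>_. borel)"

abbreviation csphere_borel :: "'i set \<Rightarrow> ('i \<Rightarrow> complex) measure" where
  "csphere_borel I \<equiv> restrict_space (cvec_borel I) (csphere I)"

definition unitary_mat :: "'i set \<Rightarrow> ('i \<Rightarrow> 'i \<Rightarrow> complex) \<Rightarrow> bool" where
  "unitary_mat I U \<longleftrightarrow>
     (\<forall>i\<in>I. \<forall>j\<in>I. (\<Sum>k\<in>I. cnj (U k i) * U k j) = (if i = j then 1 else 0))"

definition mat_apply :: "'i set \<Rightarrow> ('i \<Rightarrow> 'i \<Rightarrow> complex) \<Rightarrow> ('i \<Rightarrow> complex) \<Rightarrow> 'i \<Rightarrow> complex" where
  "mat_apply I U z = (\<lambda>i\<in>I. \<Sum>j\<in>I. U i j * z j)"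

text \<open>The normalized surface measure of the complex unit sphere, characterized as its unique
  unitarily invariant Borel probability measure.\<close>

definition uniform_on_csphere :: "'i set \<Rightarrow> ('i \<Rightarrow> complex) measure \<Rightarrow> bool" where
  "uniform_on_csphere I \<mu> \<longleftrightarrow>
     sets \<mu> = sets (csphere_borel I) \<and> prob_space \<mu> \<and>
     (\<forall>U. unitary_mat I U \<longrightarrow> distr \<mu> \<mu> (mat_apply I U) = \<mu>)"

definition square_root_cancellation ::
  "nat set \<Rightarrow> (nat \<Rightarrow> 'w measure) \<Rightarrow> (nat \<Rightarrow> 'w \<Rightarrow> int \<Rightarrow> complex) \<Rightarrow> bool" where
  "square_root_cancellation \<M> P W \<longleftrightarrow>
     (\<forall>\<epsilon>>0. \<exists>c>0. \<forall>N\<in>\<M>. \<forall>u :: nat \<Rightarrow> int \<Rightarrow> complex.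
        (\<forall>j\<in>{1..N\<^sup>2}. u j \<in> csphere (Zmod N)) \<longrightarrow>
        measure (P N) {x \<in> space (P N). \<forall>j\<in>{1..N\<^sup>2}.
            cmod (cinner (Zmod N) (W N x) (u j)) \<le> real N powr (- 1 / 2 + \<epsilon>)}
          \<ge> 1 - exp (- c * real N))"

text \<open>Independence of random variables with values in spaces over two different types, which
  the library's \<open>indep_var\<close> does not cover; cf. \<open>prob_space.indep_var_eq\<close>.\<close>

definition indep_rv ::
  "'w measure \<Rightarrow> 'a measure \<Rightarrow> ('w \<Rightarrow> 'a) \<Rightarrow> 'b measure \<Rightarrow> ('w \<Rightarrow> 'b) \<Rightarrow> bool" where
  "indep_rv P M X M' Y \<longleftrightarrow>
     X \<in> measurable P M \<and> Y \<in> measurable P M' \<and>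
     prob_space.indep_set P {X -` A \<inter> space P |A. A \<in> sets M} {Y -` B \<inter> space P |B. B \<in> sets M'}"

end

theory Submission
  imports Defs "HOL-Real_Asymp.Real_Asymp"
begin

text \<open>
  The correlation of the shifted signal with \<open>R\<close> at \<open>p\<close> is the attenuation coefficient of the target
  at \<open>p\<close> (if there is one), plus the interference \<open>\<Sum>k. cnj (\<alpha> k) * b k\<close> of the other targets, where
  \<open>cmod (b k) \<le> 1 / sqrt N\<close> by pseudo-randomness, plus the noise. Unitary invariance makes every
  unit linear combination of the \<open>\<alpha> k\<close> equal in law to a single coordinate. Averaging over the sign
  vectors divided by \<open>sqrt r\<close> turns this into an exponential moment bound, so the interference
  exceeds \<open>N powr (\<epsilon> - 1 / 2)\<close> with probability smaller than any power of \<open>N\<close>. Averaging over Gaussian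
  vectors gives the small ball bound \<open>prob (cmod (\<alpha> k) < \<eta> / sqrt r) \<le> 6 * \<eta>\<close>, so a typical
  coefficient is at least \<open>2 * N powr (\<delta> / 4 - 1 / 2)\<close>. Union bounds with \<open>\<epsilon> = \<delta> / 8\<close> finish the proof.
\<close>

section \<open>Time-frequency shifts\<close>

lemma finite_Zmod [simp]: "finite (Zmod N)"
  by (simp add: Zmod_def)

lemma card_Vmod: "card (Vmod N) = N\<^sup>2"
  by (simp add: Vmod_def Zmod_def card_cartesian_product power2_eq_square)

lemma finite_Vmod [simp]: "finite (Vmod N)"
  by (simp add: Vmod_def)

lemma mod_in_Zmod: "N > 0 \<Longrightarrow> t mod int N \<in> Zmod N"
  by (simp add: Zmod_def)

lemma echar_eq_cis: "echar N t = cis (2 * pi * real_of_int t / real N)"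
  by (simp add: echar_def cis_conv_exp field_simps)

lemma cmod_echar [simp]: "cmod (echar N t) = 1"
  by (simp add: echar_eq_cis)

lemma echar_add: "echar N (s + t) = echar N s * echar N t"
  by (simp add: echar_eq_cis cis_mult add_divide_distrib ring_distribs)

lemma cnj_echar: "cnj (echar N t) = echar N (- t)"
  by (simp add: echar_eq_cis cis_cnj)

lemma echar_mult_period: "N > 0 \<Longrightarrow> echar N (int N * k) = 1"
  using cis_multiple_2pi[of "real_of_int k"] by (simp add: echar_eq_cis mult.assoc)

lemma echar_cong:
  assumes "N > 0" "s mod int N = t mod int N"
  shows "echar N s = echar N t"
proof -
  obtain k where "s = t + int N * k"
    using assms(2) by (metis mod_eqE)
  then show ?thesis
    using assms(1) by (simp add: echar_add echar_mult_period)
qed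

lemma bij_betw_shift_Zmod:
  assumes "N > 0"
  shows "bij_betw (\<lambda>n. (n - \<tau>) mod int N) (Zmod N) (Zmod N)"
proof (rule bij_betw_byWitness[where f' = "\<lambda>n. (n + \<tau>) mod int N"])
  show "\<forall>a\<in>Zmod N. ((a - \<tau>) mod int N + \<tau>) mod int N = a"
    by (auto simp: Zmod_def mod_simps)
  show "\<forall>a\<in>Zmod N. ((a + \<tau>) mod int N - \<tau>) mod int N = a"
    by (auto simp: Zmod_def mod_simps)
qed (use assms in \<open>auto simp: Zmod_def\<close>)

lemma sum_shift_Zmod:
  "N > 0 \<Longrightarrow> (\<Sum>n\<in>Zmod N. f ((n - \<tau>) mod int N)) = (\<Sum>n\<in>Zmod N. f n)"
  by (rule sum.reindex_bij_betw[OF bij_betw_shift_Zmod])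

lemma tf_shift_in_csphere:
  assumes "N > 0" "f \<in> csphere (Zmod N)"
  shows "tf_shift N v f \<in> csphere (Zmod N)"
proof -
  obtain \<tau> \<omega> where v: "v = (\<tau>, \<omega>)" by (cases v)
  have "(\<Sum>n\<in>Zmod N. (cmod (f ((n - \<tau>) mod int N)))\<^sup>2) = 1"
    using assms(2) sum_shift_Zmod[OF assms(1), of "\<lambda>n. (cmod (f n))\<^sup>2" \<tau>] by (simp add: csphere_def)
  then show ?thesis
    by (simp add: csphere_def tf_shift_def v norm_mult)
qed

lemma cinner_self: "f \<in> csphere I \<Longrightarrow> cinner I f f = 1"
  by (simp add: csphere_def cinner_def complex_norm_square[symmetric] flip: of_real_power of_real_sum)

lemma cinner_commute: "cinner I g f = cnj (cinner I f g)"
  by (simp add: cinner_def mult.commute)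

text \<open>The substitution \<open>n - \<tau>'\<close> turns the sum into the ambiguity sum at the
  difference of the two points, up to a phase factor of modulus one that \<open>cmod\<close>
  removes.\<close>

lemma cmod_cinner_tf_shift:
  assumes "N > 0"
  shows "cmod (cinner (Zmod N) (tf_shift N (\<tau>, \<omega>) f) (tf_shift N (\<tau>', \<omega>') f)) =
    cmod (ambiguity N f f ((\<tau> - \<tau>') mod int N, (\<omega> - \<omega>') mod int N))"
proof -
  let ?m = "\<lambda>n. (n - \<tau>') mod int N"
  \<comment> \<open>\<open>h\<close> is the summand of the ambiguity function at the reduced
    difference; \<open>echar_cong\<close> permits reducing the frequency modulo
    \<open>N\<close>.\<close>
  define h where "h m = echar N ((\<omega> - \<omega>') mod int N * m) *
    f ((m - (\<tau> - \<tau>') mod int N) mod int N) * cnj (f m)" for m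
  have "echar N (\<omega> * n) * f ((n - \<tau>) mod int N) * cnj (echar N (\<omega>' * n) * f (?m n)) =
      echar N ((\<omega> - \<omega>') * \<tau>') * h (?m n)" for n
  proof -
    have "echar N (\<omega> * n) * cnj (echar N (\<omega>' * n)) = echar N ((\<omega> - \<omega>') * n)"
      by (simp add: cnj_echar left_diff_distrib flip: echar_add)
    also have "\<dots> = echar N ((\<omega> - \<omega>') * \<tau>' + (\<omega> - \<omega>') mod int N * ?m n)"
    proof (rule echar_cong[OF assms])
      have "((\<omega> - \<omega>') * \<tau>' + (\<omega> - \<omega>') mod int N * ?m n) mod int N =
          ((\<omega> - \<omega>') * \<tau>' + (\<omega> - \<omega>') * (n - \<tau>')) mod int N"
        by (metis mod_add_right_eq mod_mult_eq)
      then show "(\<omega> - \<omega>') * n mod int N =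
          ((\<omega> - \<omega>') * \<tau>' + (\<omega> - \<omega>') mod int N * ?m n) mod int N"
        by (simp add: algebra_simps)
    qed
    finally have "echar N (\<omega> * n) * cnj (echar N (\<omega>' * n)) =
        echar N ((\<omega> - \<omega>') * \<tau>') * echar N ((\<omega> - \<omega>') mod int N * ?m n)"
      by (simp add: echar_add)
    moreover have "(?m n - (\<tau> - \<tau>') mod int N) mod int N = (n - \<tau>) mod int N"
      by (simp add: mod_simps)
    ultimately show ?thesis
      by (simp add: h_def mult_ac)
  qed
  then have "cinner (Zmod N) (tf_shift N (\<tau>, \<omega>) f) (tf_shift N (\<tau>', \<omega>') f) =
      echar N ((\<omega> - \<omega>') * \<tau>') * (\<Sum>n\<in>Zmod N. h (?m n))"
    by (simp add: cinner_def tf_shift_def sum_distrib_left)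
  also have "(\<Sum>n\<in>Zmod N. h (?m n)) =
      ambiguity N f f ((\<tau> - \<tau>') mod int N, (\<omega> - \<omega>') mod int N)"
    unfolding sum_shift_Zmod[OF assms]
    by (simp add: ambiguity_def cinner_def tf_shift_def h_def)
  finally show ?thesis by (simp add: norm_mult)
qed

text \<open>Pseudo-randomness only bounds the self-ambiguity; the inner product of two shifts has
  the modulus of a self-ambiguity value at the difference of the two points.\<close>

lemma pseudo_random_cross_bound:
  assumes "N > 0" "pseudo_random N B f" "v \<in> Vmod N" "v' \<in> Vmod N" "v \<noteq> v'"
  shows "cmod (cinner (Zmod N) (tf_shift N v f) (tf_shift N v' f)) \<le> B / sqrt (real N)"
proof -
  obtain \<tau> \<omega> \<tau>' \<omega>' where v: "v = (\<tau>, \<omega>)" "v' = (\<tau>', \<omega>')"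
    by (cases v, cases v')
  \<comment> \<open>Residues in \<open>Zmod N\<close> that agree modulo \<open>N\<close> are equal,
    so the reduced difference of distinct points is not \<open>(0, 0)\<close>.\<close>
  have *: "s = t" if "(s - t) mod int N = 0" "s \<in> Zmod N" "t \<in> Zmod N" for s t
    using that by (metis Zmod_def atLeastLessThan_iff mod_eq_dvd_iff mod_pos_pos_trivial dvd_eq_mod_eq_0)
  have "((\<tau> - \<tau>') mod int N, (\<omega> - \<omega>') mod int N) \<in> Vmod N - {(0, 0)}"
    using assms v *[of \<tau> \<tau>'] *[of \<omega> \<omega>'] by (auto simp: Vmod_def mod_in_Zmod)
  then show ?thesis
    using assms(2) unfolding pseudo_random_def v cmod_cinner_tf_shift[OF assms(1)] by blast
qed


section \<open>Unitarily invariant measures on the sphere\<close>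

text \<open>Lets an arbitrary unit linear combination be read as coordinate \<open>j\<close> of a
  rotated point. A reflection gives an explicit matrix unless \<open>u j = 1\<close>; then
  \<open>u\<close> is the \<open>j\<close>-th basis vector and the identity matrix serves.\<close>

lemma unitary_mat_with_row:
  assumes I: "finite I" "j \<in> I" and u: "(\<Sum>k\<in>I. (cmod (u k))\<^sup>2) = 1"
  shows "\<exists>U. unitary_mat I U \<and> (\<forall>k\<in>I. U j k = u k)"
proof (cases "u j = 1")
  case True
  have "(\<Sum>k\<in>I - {j}. (cmod (u k))\<^sup>2) = 0"
    using u True I by (simp add: sum.remove)
  then have "\<forall>k\<in>I - {j}. u k = 0"
    using I by (subst (asm) sum_nonneg_eq_0_iff) auto
  then show ?thesis
    using True I
    by (intro exI[of _ "\<lambda>i k. of_bool (i = k)"])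
       (auto simp: unitary_mat_def of_bool_def if_distrib[of cnj] sum.delta mult_if_delta cong: if_cong)
next
  case False
  \<comment> \<open>a complex Householder reflection; the scaling \<open>c * w j = 1\<close> gives the row, and makes it unitary\<close>
  define w where "w k = of_bool (j = k) - cnj (u k)" for k
  define c where "c = 1 / w j"
  define H where "H i k = of_bool (i = k) - c * w i * cnj (w k)" for i k
  have wj: "w j \<noteq> 0"
    using False by (metis complex_cnj_one_iff eq_iff_diff_eq_0 of_bool_eq(2) w_def)
  \<comment> \<open>Since \<open>c = 1 / w j\<close>, the squared norm of \<open>w\<close> is
    \<open>1 / c + 1 / cnj c\<close>, exactly the relation that cancels the rank-one terms in the
    product of the adjoint of \<open>H\<close> with \<open>H\<close>.\<close>
  have ww: "(\<Sum>i\<in>I. w i * cnj (w i)) = w j + cnj (w j)"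
  proof -
    have uu: "(\<Sum>i\<in>I. u i * cnj (u i)) = 1"
      using u by (simp add: complex_norm_square[symmetric] flip: of_real_power of_real_sum)
    have "(\<Sum>i\<in>I. w i * cnj (w i)) =
        (\<Sum>i\<in>I. (if j = i then 1 - u i - cnj (u i) else 0) + u i * cnj (u i))"
      by (rule sum.cong) (auto simp: w_def algebra_simps)
    also have "\<dots> = w j + cnj (w j)"
      using I uu by (simp add: sum.distrib w_def)
    finally show ?thesis .
  qed
  have "(\<Sum>i\<in>I. cnj (H i a) * H i b) = of_bool (a = b)" if ab: "a \<in> I" "b \<in> I" for a b
  proof -
    have "(\<Sum>i\<in>I. cnj (H i a) * H i b) =
        (\<Sum>i\<in>I. (if i = a then of_bool (a = b) - c * w a * cnj (w b) else 0) +
          (if i = b then - cnj c * cnj (w b) * w a else 0) +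
          (cnj c * c * w a * cnj (w b)) * (w i * cnj (w i)))"
      by (rule sum.cong) (auto simp: H_def algebra_simps)
    also have "\<dots> = of_bool (a = b) - c * w a * cnj (w b) - cnj c * cnj (w b) * w a +
        (cnj c * c * w a * cnj (w b)) * (w j + cnj (w j))"
      using I ab by (simp add: sum.distrib ww flip: sum_distrib_left)
    also have "\<dots> = of_bool (a = b)"
      using wj by (simp add: c_def field_simps)
    finally show ?thesis .
  qed
  then have "unitary_mat I H"
    by (simp add: unitary_mat_def of_bool_def)
  moreover have "H j k = u k" for k
    using wj by (simp add: H_def c_def w_def)
  ultimately show ?thesis by blast
qed

text \<open>Writing the squared norm as a triple sum and moving the sum over rows innermost exposes
  the orthonormality relation of the columns.\<close>

lemma mat_apply_csphere:
  assumes "finite I" "unitary_mat I U" "z \<in> csphere I"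
  shows "mat_apply I U z \<in> csphere I"
proof -
  have "complex_of_real (\<Sum>i\<in>I. (cmod (\<Sum>j\<in>I. U i j * z j))\<^sup>2) =
      (\<Sum>i\<in>I. \<Sum>j\<in>I. \<Sum>k\<in>I. z j * cnj (z k) * (cnj (U i k) * U i j))"
    by (simp only: of_real_sum complex_norm_square cnj_sum sum_product complex_cnj_mult mult_ac)
  also have "\<dots> = (\<Sum>j\<in>I. \<Sum>i\<in>I. \<Sum>k\<in>I. z j * cnj (z k) * (cnj (U i k) * U i j))"
    by (rule sum.swap)
  also have "\<dots> = (\<Sum>j\<in>I. \<Sum>k\<in>I. \<Sum>i\<in>I. z j * cnj (z k) * (cnj (U i k) * U i j))"
    by (rule sum.cong[OF refl], rule sum.swap)
  also have "\<dots> = (\<Sum>j\<in>I. \<Sum>k\<in>I. z j * cnj (z k) * (\<Sum>i\<in>I. cnj (U i k) * U i j))"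
    by (simp only: sum_distrib_left)
  also have "\<dots> = (\<Sum>j\<in>I. \<Sum>k\<in>I. z j * cnj (z k) * (if k = j then 1 else 0))"
    using assms(2) by (intro sum.cong refl) (simp add: unitary_mat_def)
  also have "\<dots> = (\<Sum>k\<in>I. z k * cnj (z k))"
    using assms(1) by (simp add: if_distrib cong: if_cong)
  also have "\<dots> = complex_of_real (\<Sum>k\<in>I. (cmod (z k))\<^sup>2)"
    by (simp only: complex_norm_square of_real_sum)
  finally show ?thesis
    using assms(3) by (simp add: csphere_def mat_apply_def del: of_real_sum)
qed

lemma measurable_mat_apply:
  assumes "finite I" "unitary_mat I U"
  shows "mat_apply I U \<in> csphere_borel I \<rightarrow>\<^sub>M csphere_borel I"
proof (rule measurable_restrict_space2)
  show "mat_apply I U \<in> space (csphere_borel I) \<rightarrow> csphere I"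
    using mat_apply_csphere[OF assms] by (auto simp: space_restrict_space)
  have "mat_apply I U \<in> cvec_borel I \<rightarrow>\<^sub>M cvec_borel I"
    unfolding mat_apply_def by measurable
  then show "mat_apply I U \<in> csphere_borel I \<rightarrow>\<^sub>M cvec_borel I"
    by (rule measurable_restrict_space1)
qed

text \<open>The sum over sign vectors factors into a product over \<open>I\<close> of
  \<open>exp (- x k) + exp (x k)\<close>. Divided by \<open>2 ^ card I\<close>, it is the
  exponential moment of a sum with independent random signs.\<close>

lemma sum_signs_exp:
  fixes x :: "'i \<Rightarrow> real"
  assumes "finite I" and x: "\<And>k. k \<in> I \<Longrightarrow> \<bar>x k\<bar> \<le> 1"
  shows "(\<Sum>\<epsilon>\<in>PiE I (\<lambda>_. {- 1, 1}). exp (\<Sum>k\<in>I. \<epsilon> k * x k)) \<le> 2 ^ card I * exp (\<Sum>k\<in>I. (x k)\<^sup>2)"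
proof -
  \<comment> \<open>On \<open>[0, 1]\<close>, \<open>exp (- t) \<le> 1 - t + t\<^sup>2\<close> and
    \<open>exp t \<le> 1 + t + t\<^sup>2\<close>; the linear terms cancel, and symmetry covers
    negative \<open>t\<close>.\<close>
  have cosh: "exp (- t) + exp t \<le> 2 * exp (t\<^sup>2)" if "\<bar>t\<bar> \<le> 1" for t :: real
  proof -
    have *: "exp (- t) + exp t \<le> 2 * exp (t\<^sup>2)" if t: "0 \<le> t" "t \<le> 1" for t :: real
    proof -
      have "exp (- t) \<le> 1 / (1 + t)"
        using t by (simp add: exp_minus field_simps add_increasing)
      also have "\<dots> \<le> 1 - t + t\<^sup>2"
        using t by (simp add: field_simps power2_eq_square)
      finally have "exp (- t) + exp t \<le> 2 * (1 + t\<^sup>2)"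
        using exp_bound[OF t] by simp
      also have "\<dots> \<le> 2 * exp (t\<^sup>2)"
        using exp_ge_add_one_self[of "t\<^sup>2"] by (intro mult_left_mono) auto
      finally show ?thesis .
    qed
    show ?thesis using *[of t] *[of "- t"] that by (cases "t \<ge> 0") (auto simp: add.commute)
  qed
  have "(\<Sum>\<epsilon>\<in>PiE I (\<lambda>_. {- 1, 1}). exp (\<Sum>k\<in>I. \<epsilon> k * x k)) =
      (\<Prod>k\<in>I. \<Sum>\<epsilon>\<in>{- 1, 1}. exp (\<epsilon> * x k))"
    by (simp add: exp_sum[OF assms(1)] prod_sum_PiE[OF assms(1)] del: sum.insert)
  also have "\<dots> \<le> (\<Prod>k\<in>I. 2 * exp ((x k)\<^sup>2))"
    using cosh[OF x] by (intro prod_mono) (auto intro: add_nonneg_nonneg)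
  also have "\<dots> = 2 ^ card I * exp (\<Sum>k\<in>I. (x k)\<^sup>2)"
    using assms(1) by (simp add: prod.distrib exp_sum)
  finally show ?thesis .
qed

section \<open>Tail bounds for linear combinations of coordinates on the sphere\<close>

locale uniform_csphere =
  fixes I :: "'i set" and \<mu> :: "('i \<Rightarrow> complex) measure"
  assumes finite_I: "finite I" and uniform: "uniform_on_csphere I \<mu>"
begin

sublocale prob_space \<mu>
  using uniform by (simp add: uniform_on_csphere_def)

lemma sets_eq [measurable_cong]: "sets \<mu> = sets (csphere_borel I)"
  using uniform by (simp add: uniform_on_csphere_def)

lemma space_eq: "space \<mu> = csphere I"
  using sets_eq_imp_space_eq[OF sets_eq]
  by (auto simp: space_restrict_space space_PiM csphere_def)

lemma measurable_coord: "k \<in> I \<Longrightarrow> (\<lambda>z. z k) \<in> borel_measurable \<mu>"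
  unfolding measurable_cong_sets[OF sets_eq refl]
  by (intro measurable_restrict_space1 measurable_component_singleton)

lemma measurable_lincomb: "(\<lambda>z. \<Sum>k\<in>I. u k * z k) \<in> borel_measurable \<mu>"
  by (intro borel_measurable_sum borel_measurable_times borel_measurable_const measurable_coord)

text \<open>For a unitary matrix with \<open>u\<close> as row \<open>j\<close>, the combination is
  coordinate \<open>j\<close> of the rotated point, and the rotated point still has law
  \<open>\<mu>\<close>. With \<open>h\<close> valued in \<open>ennreal\<close>, no integrability
  conditions arise.\<close>

lemma nn_integral_lincomb:
  assumes "j \<in> I" "(\<Sum>k\<in>I. (cmod (u k))\<^sup>2) = 1" and [measurable]: "h \<in> borel_measurable borel"
  shows "(\<integral>\<^sup>+z. h (\<Sum>k\<in>I. u k * z k) \<partial>\<mu>) = (\<integral>\<^sup>+z. h (z j) \<partial>\<mu>)"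
proof -
  obtain U where U: "unitary_mat I U" "\<And>k. k \<in> I \<Longrightarrow> U j k = u k"
    using unitary_mat_with_row[OF finite_I assms(1,2)] by blast
  have T: "mat_apply I U \<in> \<mu> \<rightarrow>\<^sub>M \<mu>"
    unfolding measurable_cong_sets[OF sets_eq sets_eq]
    by (rule measurable_mat_apply[OF finite_I U(1)])
  have "(\<integral>\<^sup>+z. h (z j) \<partial>\<mu>) = (\<integral>\<^sup>+z. h (z j) \<partial>distr \<mu> \<mu> (mat_apply I U))"
    using uniform U(1) by (simp add: uniform_on_csphere_def)
  also have "\<dots> = (\<integral>\<^sup>+z. h (mat_apply I U z j) \<partial>\<mu>)"
    using measurable_coord[OF assms(1)] by (intro nn_integral_distr[OF T]) simp
  also have "\<dots> = (\<integral>\<^sup>+z. h (\<Sum>k\<in>I. u k * z k) \<partial>\<mu>)"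
    using assms(1) U(2) by (intro nn_integral_cong arg_cong[of _ _ h]) (simp add: mat_apply_def)
  finally show ?thesis ..
qed

text \<open>The integral is the same for \<open>u\<close> and for every sign vector divided by
  \<open>sqrt (card I)\<close>. Averaging over the signs inside the integral gives a pointwise
  bound, since the squares of \<open>Re (z k)\<close> sum to at most \<open>1\<close> on the
  sphere.\<close>

lemma nn_integral_exp_lincomb_le:
  assumes "I \<noteq> {}" and u: "(\<Sum>k\<in>I. (cmod (u k))\<^sup>2) = 1"
  shows "(\<integral>\<^sup>+z. exp (sqrt (card I) * Re (\<Sum>k\<in>I. u k * z k)) \<partial>\<mu>) \<le> exp 1"
proof -
  define r where "r = real (card I)"
  have r: "r > 0" using assms finite_I by (simp add: r_def card_gt_0_iff)
  obtain j where j: "j \<in> I" using assms by auto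
  let ?E = "PiE I (\<lambda>_. {- 1, 1 :: real})"
  define h where "h w = ennreal (exp (sqrt r * Re w))" for w
  have [measurable]: "h \<in> borel_measurable borel" unfolding h_def by measurable
  define J where "J = (\<integral>\<^sup>+z. h (z j) \<partial>\<mu>)"
  \<comment> \<open>all sign vectors give the same integral \<open>J\<close>, so \<open>J\<close> is their average\<close>
  have *: "(\<integral>\<^sup>+z. exp (\<Sum>k\<in>I. \<epsilon> k * Re (z k)) \<partial>\<mu>) = J" if e: "\<epsilon> \<in> ?E" for \<epsilon>
  proof -
    have "(cmod (complex_of_real (\<epsilon> k / sqrt r)))\<^sup>2 = 1 / r" if "k \<in> I" for k
    proof -
      have "\<epsilon> k = - 1 \<or> \<epsilon> k = 1" using PiE_mem[OF e that] by simp
      then show ?thesis using r by (auto simp: power_divide norm_divide)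
    qed
    then have "(\<Sum>k\<in>I. (cmod (complex_of_real (\<epsilon> k / sqrt r)))\<^sup>2) = 1"
      using r by (simp add: r_def)
    from nn_integral_lincomb[OF j this \<open>h \<in> _\<close>]
    have "J = (\<integral>\<^sup>+z. h (\<Sum>k\<in>I. complex_of_real (\<epsilon> k / sqrt r) * z k) \<partial>\<mu>)"
      by (simp add: J_def)
    also have "\<dots> = (\<integral>\<^sup>+z. exp (\<Sum>k\<in>I. \<epsilon> k * Re (z k)) \<partial>\<mu>)"
      using r by (intro nn_integral_cong) (simp add: h_def sum_distrib_left)
    finally show ?thesis ..
  qed
  have [measurable]: "(\<lambda>z. Re (z k)) \<in> borel_measurable \<mu>" if "k \<in> I" for k
    using measurable_coord[OF that] by measurable
  have "of_nat (2 ^ card I) * J = (\<Sum>\<epsilon>\<in>?E. J)"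
    using finite_I by (simp add: card_PiE numeral_eq_Suc)
  also have "\<dots> = (\<Sum>\<epsilon>\<in>?E. \<integral>\<^sup>+z. exp (\<Sum>k\<in>I. \<epsilon> k * Re (z k)) \<partial>\<mu>)"
    by (simp add: *)
  also have "\<dots> = (\<integral>\<^sup>+z. (\<Sum>\<epsilon>\<in>?E. ennreal (exp (\<Sum>k\<in>I. \<epsilon> k * Re (z k)))) \<partial>\<mu>)"
    by (rule nn_integral_sum[symmetric]) measurable
  also have "\<dots> \<le> (\<integral>\<^sup>+z. ennreal (2 ^ card I * exp 1) \<partial>\<mu>)"
  proof (rule nn_integral_mono)
    fix z assume "z \<in> space \<mu>"
    then have z: "(\<Sum>k\<in>I. (cmod (z k))\<^sup>2) = 1"
      by (simp add: space_eq csphere_def)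
    have "(cmod (z k))\<^sup>2 \<le> 1" if "k \<in> I" for k
      unfolding z[symmetric] using that finite_I by (intro member_le_sum) auto
    then have "\<bar>Re (z k)\<bar> \<le> 1" if "k \<in> I" for k
      using that abs_Re_le_cmod[of "z k"] power_le_one_iff[of "cmod (z k)" 2] by fastforce
    then have "(\<Sum>\<epsilon>\<in>?E. exp (\<Sum>k\<in>I. \<epsilon> k * Re (z k))) \<le> 2 ^ card I * exp (\<Sum>k\<in>I. (Re (z k))\<^sup>2)"
      by (rule sum_signs_exp[OF finite_I])
    also have "(\<Sum>k\<in>I. (Re (z k))\<^sup>2) \<le> (\<Sum>k\<in>I. (cmod (z k))\<^sup>2)"
      by (intro sum_mono) (simp add: cmod_power2)
    finally show "(\<Sum>\<epsilon>\<in>?E. ennreal (exp (\<Sum>k\<in>I. \<epsilon> k * Re (z k)))) \<le> ennreal (2 ^ card I * exp 1)"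
      by (simp add: z sum_ennreal ennreal_leI)
  qed
  also have "\<dots> = of_nat (2 ^ card I) * ennreal (exp 1)"
    by (simp add: emeasure_space_1 ennreal_mult)
      (metis ennreal_numeral ennreal_power zero_le_numeral)
  finally have "J \<le> exp 1"
    by (subst (asm) ennreal_mult_le_mult_iff) (auto simp: power_eq_top_ennreal)
  moreover have "(\<integral>\<^sup>+z. exp (sqrt (card I) * Re (\<Sum>k\<in>I. u k * z k)) \<partial>\<mu>) = J"
    using nn_integral_lincomb[OF j u \<open>h \<in> _\<close>] by (simp add: J_def h_def r_def)
  ultimately show ?thesis by simp
qed

text \<open>Chernoff's argument: Markov's inequality for \<open>exp (X z)\<close> at level
  \<open>exp t\<close>, with exponential moment at most \<open>exp 1\<close>.\<close>

lemma prob_Re_lincomb_gt: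
  assumes "I \<noteq> {}" "(\<Sum>k\<in>I. (cmod (u k))\<^sup>2) = 1"
  shows "prob {z\<in>space \<mu>. Re (\<Sum>k\<in>I. u k * z k) > t / sqrt (card I)} \<le> exp (1 - t)"
proof -
  note [measurable] = measurable_lincomb[of u]
  define X where "X z = sqrt (card I) * Re (\<Sum>k\<in>I. u k * z k)" for z
  have [measurable]: "X \<in> borel_measurable \<mu>" unfolding X_def by measurable
  have r: "sqrt (card I) > 0" using assms finite_I by (simp add: card_gt_0_iff)
  have "emeasure \<mu> {z\<in>space \<mu>. Re (\<Sum>k\<in>I. u k * z k) > t / sqrt (card I)} \<le>
      emeasure \<mu> {z\<in>space \<mu>. 1 \<le> ennreal (exp (- t)) * ennreal (exp (X z))}"
  proof (rule emeasure_mono)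
    show "{z\<in>space \<mu>. Re (\<Sum>k\<in>I. u k * z k) > t / sqrt (card I)} \<subseteq>
        {z\<in>space \<mu>. 1 \<le> ennreal (exp (- t)) * ennreal (exp (X z))}"
      using r by (auto simp: X_def pos_divide_less_eq mult.commute simp flip: ennreal_mult exp_add)
  qed measurable
  also have "\<dots> \<le> ennreal (exp (- t)) * (\<integral>\<^sup>+z. ennreal (exp (X z)) * indicator (space \<mu>) z \<partial>\<mu>)"
    using nn_integral_Markov_inequality[of "\<lambda>z. ennreal (exp (X z))" "space \<mu>" \<mu> "ennreal (exp (- t))"]
    by simp
  also have "(\<integral>\<^sup>+z. ennreal (exp (X z)) * indicator (space \<mu>) z \<partial>\<mu>) = (\<integral>\<^sup>+z. exp (X z) \<partial>\<mu>)"
    by (intro nn_integral_cong) auto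
  also have "ennreal (exp (- t)) * (\<integral>\<^sup>+z. exp (X z) \<partial>\<mu>) \<le> ennreal (exp (- t)) * ennreal (exp 1)"
    unfolding X_def by (intro mult_left_mono nn_integral_exp_lincomb_le[OF assms]) simp
  also have "\<dots> = ennreal (exp (1 - t))"
    by (simp flip: ennreal_mult exp_add)
  finally show ?thesis
    by (simp only: emeasure_eq_measure ennreal_le_iff exp_ge_zero)
qed

text \<open>A complex number of modulus above a threshold has a multiple by \<open>1\<close>,
  \<open>-1\<close>, \<open>\<i>\<close> or \<open>-\<i>\<close> whose real part exceeds half of it.
  The union bound over these rotations gives the factor \<open>4\<close> and the exponent
  \<open>s / 2\<close>.\<close>

lemma prob_lincomb_gt:
  assumes "I \<noteq> {}" "B > 0" "s \<ge> 0" and b: "(\<Sum>k\<in>I. (cmod (b k))\<^sup>2) \<le> B\<^sup>2"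
  shows "prob {z\<in>space \<mu>. cmod (\<Sum>k\<in>I. b k * z k) > B * s / sqrt (card I)} \<le> 4 * exp (1 - s / 2)"
proof (cases "(\<Sum>k\<in>I. (cmod (b k))\<^sup>2) = 0")
  case True
  then have "\<forall>k\<in>I. b k = 0"
    using finite_I by (subst (asm) sum_nonneg_eq_0_iff) auto
  then have "{z\<in>space \<mu>. cmod (\<Sum>k\<in>I. b k * z k) > B * s / sqrt (card I)} = {}"
    using assms(2,3) by (auto simp: not_less)
  then show ?thesis by (simp only: measure_empty) simp
next
  case False
  \<comment> \<open>\<open>\<beta>\<close> is the exact norm of \<open>b\<close>, by which the
    coefficients are normalised; \<open>B\<close> only bounds it from above. The case
    \<open>\<beta> = 0\<close> has been treated separately.\<close>
  define \<beta> where "\<beta> = sqrt (\<Sum>k\<in>I. (cmod (b k))\<^sup>2)"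
  have \<beta>: "\<beta> > 0" "\<beta> \<le> B" "\<beta>\<^sup>2 = (\<Sum>k\<in>I. (cmod (b k))\<^sup>2)"
    using False b assms(2) by (auto simp: \<beta>_def sum_nonneg less_le intro!: real_le_lsqrt)
  define Q where "Q p = {z\<in>space \<mu>. Re (\<Sum>k\<in>I. p * b k / \<beta> * z k) > s / 2 / sqrt (card I)}" for p
  have Q: "prob (Q p) \<le> exp (1 - s / 2)" if "cmod p = 1" for p
    unfolding Q_def using \<beta>(1) that
    by (intro prob_Re_lincomb_gt assms(1))
       (simp add: norm_mult norm_divide power_mult_distrib power_divide \<beta>(3) False flip: sum_divide_distrib)
  have Q_sets: "Q p \<in> events" for p
    unfolding Q_def using measurable_lincomb[of "\<lambda>k. p * b k / \<beta>"] by measurable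
  have "{z\<in>space \<mu>. cmod (\<Sum>k\<in>I. b k * z k) > B * s / sqrt (card I)} \<subseteq> (\<Union>p\<in>{1, -1, \<i>, -\<i>}. Q p)"
  proof (intro subsetI)
    fix z assume z: "z \<in> {z\<in>space \<mu>. cmod (\<Sum>k\<in>I. b k * z k) > B * s / sqrt (card I)}"
    define w where "w = (\<Sum>k\<in>I. b k * z k)"
    have pw: "(\<Sum>k\<in>I. p * b k / \<beta> * z k) = p * w / \<beta>" for p
      by (simp add: w_def sum_distrib_left sum_divide_distrib mult_ac)
    have "\<beta> * (s / sqrt (card I)) \<le> B * (s / sqrt (card I))"
      using \<beta>(2) assms(3) by (intro mult_right_mono) auto
    also have "\<dots> < cmod w" using z by (simp add: w_def)
    also have "\<dots> \<le> \<bar>Re w\<bar> + \<bar>Im w\<bar>" by (rule cmod_le)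
    finally have "2 * (s / 2 / sqrt (card I)) < \<bar>Re w / \<beta>\<bar> + \<bar>Im w / \<beta>\<bar>"
      using \<beta>(1) by (simp add: pos_less_divide_eq abs_divide mult.commute flip: add_divide_distrib)
    then have "s / 2 / sqrt (card I) < \<bar>Re w / \<beta>\<bar> \<or> s / 2 / sqrt (card I) < \<bar>Im w / \<beta>\<bar>"
      by linarith
    moreover have "Re (1 * w / \<beta>) = Re w / \<beta>" "Re (- 1 * w / \<beta>) = - (Re w / \<beta>)"
        "Re (\<i> * w / \<beta>) = - (Im w / \<beta>)" "Re (- \<i> * w / \<beta>) = Im w / \<beta>"
      by simp_all
    ultimately have "\<exists>p\<in>{1, -1, \<i>, -\<i>}. s / 2 / sqrt (card I) < Re (p * w / \<beta>)"
      by (metis abs_if insert_iff)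
    then show "z \<in> (\<Union>p\<in>{1, -1, \<i>, -\<i>}. Q p)"
      using z by (simp only: Q_def pw UN_iff mem_Collect_eq) fast
  qed
  then have "prob {z\<in>space \<mu>. cmod (\<Sum>k\<in>I. b k * z k) > B * s / sqrt (card I)} \<le>
      prob (\<Union>p\<in>{1, -1, \<i>, -\<i>}. Q p)"
    by (rule finite_measure_mono) (intro sets.finite_UN finite.intros Q_sets)
  also have "\<dots> \<le> (\<Sum>p\<in>{1, -1, \<i>, -\<i>}. prob (Q p))"
    by (intro finite_measure_subadditive_finite finite.intros image_subsetI Q_sets)
  also have "\<dots> \<le> (\<Sum>p\<in>{1, -1, \<i>, -\<i>}. exp (1 - s / 2))"
    by (intro sum_mono Q) auto
  also have "\<dots> \<le> 4 * exp (1 - s / 2)"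
    by (simp add: card_insert_if)
  finally show ?thesis .
qed

end


section \<open>Gaussian vectors and the small ball bound\<close>

lemma nn_integral_eq_emeasure:
  assumes "{x\<in>space M. Q x} \<in> sets M" "\<And>x. x \<in> space M \<Longrightarrow> f x = indicator {x. Q x} x"
  shows "(\<integral>\<^sup>+x. f x \<partial>M) = emeasure M {x\<in>space M. Q x}"
proof -
  have "(\<integral>\<^sup>+x. f x \<partial>M) = (\<integral>\<^sup>+x. indicator {x\<in>space M. Q x} x \<partial>M)"
    using assms(2) by (intro nn_integral_cong) (auto split: split_indicator)
  then show ?thesis using assms(1) by simp
qed

text \<open>A variance of at least \<open>1 / 2\<close> keeps the density below \<open>1\<close>, so
  the probability is at most the length of the interval.\<close>

lemma (in prob_space) prob_normal_small_ball:
  assumes X: "distributed M lborel X (normal_density 0 \<sigma>)" and "\<sigma>\<^sup>2 \<ge> 1 / 2" "t \<ge> 0"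
  shows "prob {x\<in>space M. \<bar>X x\<bar> < t} \<le> 2 * t"
proof -
  have le_1: "normal_density 0 \<sigma> x \<le> 1" for x
  proof -
    have "1 \<le> 2 * pi * \<sigma>\<^sup>2"
      using mult_mono[of 1 pi "1 / 2" "\<sigma>\<^sup>2"] assms(2) pi_gt3 by simp
    then have "1 / sqrt (2 * pi * \<sigma>\<^sup>2) \<le> 1"
      by (simp add: divide_le_eq_1)
    then have "1 / sqrt (2 * pi * \<sigma>\<^sup>2) * exp (- (x - 0)\<^sup>2 / (2 * \<sigma>\<^sup>2)) \<le> 1 * 1"
      by (intro mult_mono) auto
    then show ?thesis by (simp add: normal_density_def)
  qed
  have "emeasure M {x\<in>space M. \<bar>X x\<bar> < t} = emeasure M (X -` {- t<..<t} \<inter> space M)"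
    by (intro arg_cong[of _ _ "emeasure M"]) (auto simp: abs_less_iff)
  also have "\<dots> = (\<integral>\<^sup>+x. ennreal (normal_density 0 \<sigma> x) * indicator {- t<..<t} x \<partial>lborel)"
    using distributed_emeasure[OF X, of "{- t<..<t}"] by simp
  also have "\<dots> \<le> (\<integral>\<^sup>+x. indicator {- t<..<t} x \<partial>lborel)"
    using le_1 by (intro nn_integral_mono) (auto split: split_indicator)
  also have "\<dots> = ennreal (2 * t)"
    using assms(3) by simp
  finally show ?thesis
    using assms(3) by (simp add: emeasure_eq_measure)
qed

text \<open>The joint law of the coordinates is the product measure itself, which is the product of
  the marginals.\<close>

lemma indep_vars_PiM_coordinates:
  assumes "I \<noteq> {}" "\<And>i. i \<in> I \<Longrightarrow> prob_space (M i)"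
  shows "prob_space.indep_vars (PiM I M) M (\<lambda>i \<omega>. \<omega> i) I"
proof -
  interpret prob_space "PiM I M" by (rule prob_space_PiM) fact
  have "distr (PiM I M) (PiM I M) (\<lambda>\<omega>. \<lambda>i\<in>I. \<omega> i) = distr (PiM I M) (PiM I M) (\<lambda>\<omega>. \<omega>)"
    by (rule distr_cong) (auto simp: space_PiM)
  also have "\<dots> = PiM I (\<lambda>i. distr (PiM I M) (M i) (\<lambda>\<omega>. \<omega> i))"
    using assms(2) by (simp add: distr_id2 distr_PiM_component cong: PiM_cong)
  finally show ?thesis
    using assms(1) by (subst indep_vars_iff_distr_eq_PiM') auto
qed

abbreviation std_gaussian :: "'i set \<Rightarrow> ('i \<Rightarrow> real) measure" where
  "std_gaussian I \<equiv> PiM I (\<lambda>_. density lborel std_normal_density)"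

lemma prob_space_std_gaussian: "prob_space (std_gaussian I)"
  by (intro prob_space_PiM prob_space_normal_density) simp

lemma std_gaussian_coord:
  assumes "k \<in> I"
  shows "distributed (std_gaussian I) lborel (\<lambda>g. g k) std_normal_density"
proof -
  have "(\<lambda>g. g k) \<in> std_gaussian I \<rightarrow>\<^sub>M density lborel std_normal_density"
    using assms by (rule measurable_component_singleton)
  then have "(\<lambda>g. g k) \<in> std_gaussian I \<rightarrow>\<^sub>M lborel"
    by (simp add: measurable_def)
  moreover have "distr (std_gaussian I) lborel (\<lambda>g. g k) =
      distr (std_gaussian I) (density lborel std_normal_density) (\<lambda>g. g k)"
    by (rule distr_cong) auto
  ultimately show ?thesis
    using assms distr_PiM_component[of I "\<lambda>_. density lborel std_normal_density" k]
    by (simp add: distributed_def prob_space_normal_density)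
qed

lemma std_gaussian_lincomb:
  assumes "finite I" "(\<Sum>k\<in>I. (a k)\<^sup>2) \<noteq> 0"
  shows "distributed (std_gaussian I) lborel (\<lambda>g. \<Sum>k\<in>I. a k * g k)
    (normal_density 0 (sqrt (\<Sum>k\<in>I. (a k)\<^sup>2)))"
proof -
  interpret prob_space "std_gaussian I" by (rule prob_space_std_gaussian)
  \<comment> \<open>The sum rule for independent normal variables requires positive standard
    deviations, so terms with \<open>a k = 0\<close> are dropped first.\<close>
  define J where "J = {k\<in>I. a k \<noteq> 0}"
  have J: "finite J" "J \<subseteq> I"
    using assms(1) by (auto simp: J_def)
  have "J \<noteq> {}"
    using assms(2) by (auto simp: J_def intro!: sum.neutral)
  have "indep_vars (\<lambda>_. density lborel std_normal_density) (\<lambda>k g. g k) I"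
    using J \<open>J \<noteq> {}\<close> by (intro indep_vars_PiM_coordinates prob_space_normal_density) auto
  from indep_vars_subset[OF this J(2)]
  have indep: "indep_vars (\<lambda>_. borel) (\<lambda>k g. a k * g k) J"
    by (rule indep_vars_compose2) simp
  have normal: "distributed (std_gaussian I) lborel (\<lambda>g. a k * g k) (normal_density 0 \<bar>a k\<bar>)" if "k \<in> J" for k
    using normal_density_affine[OF std_gaussian_coord[of k I], of "a k" 0] that by (simp add: J_def)
  have "\<bar>a k\<bar> > 0" if "k \<in> J" for k
    using that by (simp add: J_def)
  from sum_indep_normal[OF J(1) \<open>J \<noteq> {}\<close> indep this normal]
  have "distributed (std_gaussian I) lborel (\<lambda>g. \<Sum>k\<in>J. a k * g k)
      (normal_density 0 (sqrt (\<Sum>k\<in>J. (a k)\<^sup>2)))" by simp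
  moreover have "(\<Sum>k\<in>J. (a k)\<^sup>2) = (\<Sum>k\<in>I. (a k)\<^sup>2)"
    using J(2) by (intro sum.mono_neutral_left assms(1)) (auto simp: J_def)
  moreover have "(\<Sum>k\<in>J. a k * g k) = (\<Sum>k\<in>I. a k * g k)" for g
    using J(2) by (intro sum.mono_neutral_left assms(1)) (auto simp: J_def)
  ultimately show ?thesis by simp
qed

text \<open>The squared norm has mean \<open>card I\<close>, so Markov's inequality bounds the
  complementary probability by \<open>1 / 4\<close>.\<close>

lemma std_gaussian_norm_sq_le:
  assumes "finite I" "I \<noteq> {}"
  shows "emeasure (std_gaussian I) {g\<in>space (std_gaussian I). (\<Sum>k\<in>I. (g k)\<^sup>2) \<le> 4 * card I} \<ge> 3 / 4"
proof -
  interpret prob_space "std_gaussian I" by (rule prob_space_std_gaussian)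
  let ?G = "std_gaussian I"
  define X where "X g = (\<Sum>k\<in>I. (g k)\<^sup>2)" for g :: "'a \<Rightarrow> real"
  have coord: "(\<lambda>g. g k) \<in> borel_measurable ?G" if "k \<in> I" for k
    using std_gaussian_coord[OF that] by (simp add: distributed_def measurable_lborel1)
  then have X [measurable]: "X \<in> borel_measurable ?G"
    unfolding X_def by (intro borel_measurable_sum borel_measurable_power) auto
  have "(\<integral>\<^sup>+x. std_normal_density x * ennreal (x\<^sup>2) \<partial>lborel) = 1"
    using nn_integral_eq_integral[of lborel "\<lambda>x. std_normal_density x * x\<^sup>2"]
      integral_std_normal_moment_even[of 1] integrable_std_normal_moment[of 2]
    by (simp add: ennreal_mult)
  then have second_moment: "(\<integral>\<^sup>+g. (g k)\<^sup>2 \<partial>?G) = 1" if "k \<in> I" for k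
    using distributed_nn_integral[OF std_gaussian_coord[OF that], of "\<lambda>x. ennreal (x\<^sup>2)"] by simp
  have coord_sq: "(\<lambda>g. ennreal ((g k)\<^sup>2)) \<in> borel_measurable ?G" if "k \<in> I" for k
    using coord[OF that] by measurable
  have "(\<integral>\<^sup>+g. X g \<partial>?G) = (\<integral>\<^sup>+g. (\<Sum>k\<in>I. ennreal ((g k)\<^sup>2)) \<partial>?G)"
    by (simp add: X_def)
  also have "\<dots> = (\<Sum>k\<in>I. \<integral>\<^sup>+g. (g k)\<^sup>2 \<partial>?G)"
    by (rule nn_integral_sum) (rule coord_sq)
  finally have EX: "(\<integral>\<^sup>+g. X g \<partial>?G) = of_nat (card I)"
    by (simp add: second_moment)
  define r where "r = real (card I)"
  have r: "r > 0" using assms by (simp add: r_def card_gt_0_iff)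
  have "emeasure ?G {g\<in>space ?G. \<not> X g \<le> 4 * r} \<le>
      emeasure ?G {g\<in>space ?G. 1 \<le> ennreal (1 / (4 * r)) * ennreal (X g)}"
  proof (rule emeasure_mono)
    have "1 \<le> ennreal (1 / (4 * r)) * ennreal (X g)" if "\<not> X g \<le> 4 * r" for g
      using that r by (simp add: pos_le_divide_eq flip: ennreal_mult')
    then show "{g\<in>space ?G. \<not> X g \<le> 4 * r} \<subseteq>
        {g\<in>space ?G. 1 \<le> ennreal (1 / (4 * r)) * ennreal (X g)}" by blast
  qed measurable
  also have "\<dots> \<le> ennreal (1 / (4 * r)) * (\<integral>\<^sup>+g. ennreal (X g) * indicator (space ?G) g \<partial>?G)"
    using nn_integral_Markov_inequality[of "\<lambda>g. ennreal (X g)" "space ?G" ?G "ennreal (1 / (4 * r))"] by simp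
  also have "(\<integral>\<^sup>+g. ennreal (X g) * indicator (space ?G) g \<partial>?G) = (\<integral>\<^sup>+g. X g \<partial>?G)"
    by (intro nn_integral_cong) auto
  also have "ennreal (1 / (4 * r)) * \<dots> = ennreal (1 / 4)"
    using r by (simp add: EX r_def ennreal_of_nat_eq_real_of_nat flip: ennreal_mult)
  finally have "prob {g\<in>space ?G. \<not> X g \<le> 4 * r} \<le> 1 / 4"
    by (simp add: emeasure_eq_measure)
  then have "prob {g\<in>space ?G. X g \<le> 4 * r} \<ge> 3 / 4"
    using prob_neg[of "\<lambda>g. X g \<le> 4 * r"] by simp
  then have "ennreal (3 / 4) \<le> emeasure ?G {g\<in>space ?G. X g \<le> 4 * r}"
    by (simp only: emeasure_eq_measure ennreal_leI)
  then show ?thesis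
    by (simp add: X_def r_def divide_ennreal[symmetric])
qed

text \<open>The real or the imaginary parts of \<open>z\<close> carry at least half of its squared
  norm. The corresponding part of the sum is a real Gaussian of variance at least
  \<open>1 / 2\<close>, and the modulus dominates it.\<close>

lemma std_gaussian_lincomb_small_ball:
  assumes "finite I" "z \<in> csphere I" "t \<ge> 0"
  shows "emeasure (std_gaussian I) {g\<in>space (std_gaussian I). cmod (\<Sum>k\<in>I. of_real (g k) * z k) < t} \<le> 2 * t"
proof -
  interpret prob_space "std_gaussian I" by (rule prob_space_std_gaussian)
  let ?G = "std_gaussian I"
  have *: "emeasure ?G {g\<in>space ?G. cmod (\<Sum>k\<in>I. of_real (g k) * z k) < t} \<le> 2 * t"
    if a: "(\<Sum>k\<in>I. (a k)\<^sup>2) \<ge> 1 / 2"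
      and le: "\<And>g. \<bar>\<Sum>k\<in>I. a k * g k\<bar> \<le> cmod (\<Sum>k\<in>I. of_real (g k) * z k)" for a
  proof -
    have D: "distributed ?G lborel (\<lambda>g. \<Sum>k\<in>I. a k * g k) (normal_density 0 (sqrt (\<Sum>k\<in>I. (a k)\<^sup>2)))"
      using a assms(1) by (intro std_gaussian_lincomb) auto
    then have [measurable]: "(\<lambda>g. \<Sum>k\<in>I. a k * g k) \<in> borel_measurable ?G"
      by (simp add: distributed_def measurable_lborel1)
    have "emeasure ?G {g\<in>space ?G. cmod (\<Sum>k\<in>I. of_real (g k) * z k) < t} \<le>
        emeasure ?G {g\<in>space ?G. \<bar>\<Sum>k\<in>I. a k * g k\<bar> < t}"
      using le by (intro emeasure_mono) (auto intro: le_less_trans)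
    also have "\<dots> \<le> 2 * t"
      using prob_normal_small_ball[OF D _ assms(3)] a
      by (simp add: emeasure_eq_measure ennreal_leI)
    finally show ?thesis .
  qed
  have "(\<Sum>k\<in>I. (Re (z k))\<^sup>2) + (\<Sum>k\<in>I. (Im (z k))\<^sup>2) = 1"
    using assms(2) by (simp add: csphere_def cmod_power2 sum.distrib)
  then consider "(\<Sum>k\<in>I. (Re (z k))\<^sup>2) \<ge> 1 / 2" | "(\<Sum>k\<in>I. (Im (z k))\<^sup>2) \<ge> 1 / 2"
    by linarith
  then show ?thesis
  proof cases
    case 1
    have "\<bar>\<Sum>k\<in>I. Re (z k) * g k\<bar> \<le> cmod (\<Sum>k\<in>I. of_real (g k) * z k)" for g
      using abs_Re_le_cmod[of "\<Sum>k\<in>I. of_real (g k) * z k"] by (simp add: mult.commute)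
    then show ?thesis by (rule *[OF 1])
  next
    case 2
    have "\<bar>\<Sum>k\<in>I. Im (z k) * g k\<bar> \<le> cmod (\<Sum>k\<in>I. of_real (g k) * z k)" for g
      using abs_Im_le_cmod[of "\<Sum>k\<in>I. of_real (g k) * z k"] by (simp add: mult.commute)
    then show ?thesis by (rule *[OF 2])
  qed
qed

section \<open>The small ball bound for a single coordinate\<close>

context uniform_csphere
begin

text \<open>With \<open>\<rho>\<close> the norm of \<open>g\<close>, the modulus of the combination
  has the law of \<open>\<rho> * cmod (z j)\<close>, and \<open>\<rho> \<le> s\<close>. If
  \<open>\<rho> = 0\<close>, the event on the right is the whole space.\<close>

lemma emeasure_real_lincomb_ge:
  assumes "j \<in> I" "t > 0" "s > 0" and g: "(\<Sum>k\<in>I. (g k)\<^sup>2) \<le> s\<^sup>2"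
  shows "emeasure \<mu> {z\<in>space \<mu>. cmod (z j) < t / s} \<le>
    emeasure \<mu> {z\<in>space \<mu>. cmod (\<Sum>k\<in>I. of_real (g k) * z k) < t}"
proof (cases "(\<Sum>k\<in>I. (g k)\<^sup>2) = 0")
  case True
  then have "\<forall>k\<in>I. g k = 0"
    using finite_I by (subst (asm) sum_nonneg_eq_0_iff) auto
  then have "{z\<in>space \<mu>. cmod (\<Sum>k\<in>I. of_real (g k) * z k) < t} = space \<mu>"
    using assms(2) by auto
  then show ?thesis using emeasure_le_1 by (simp add: emeasure_space_1)
next
  case False
  note [measurable] = measurable_coord[OF assms(1)] measurable_lincomb[of "\<lambda>k. of_real (g k)"]
  define \<rho> where "\<rho> = sqrt (\<Sum>k\<in>I. (g k)\<^sup>2)"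
  have \<rho>: "\<rho> > 0" "\<rho> \<le> s" "\<rho>\<^sup>2 = (\<Sum>k\<in>I. (g k)\<^sup>2)"
    using False g assms(3) by (auto simp: \<rho>_def sum_nonneg less_le intro!: real_le_lsqrt)
  define h where "h w = (indicator {w. \<rho> * cmod w < t} w :: ennreal)" for w
  have [measurable]: "h \<in> borel_measurable borel" unfolding h_def by measurable
  have "emeasure \<mu> {z\<in>space \<mu>. cmod (z j) < t / s} \<le> emeasure \<mu> {z\<in>space \<mu>. \<rho> * cmod (z j) < t}"
  proof (rule emeasure_mono)
    have "\<rho> * cmod w < t" if "cmod w < t / s" for w
    proof -
      have "\<rho> * cmod w \<le> s * cmod w" using \<rho>(2) by (intro mult_right_mono) auto
      also have "\<dots> < t" using that assms(3) by (simp add: field_simps)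
      finally show ?thesis .
    qed
    then show "{z\<in>space \<mu>. cmod (z j) < t / s} \<subseteq> {z\<in>space \<mu>. \<rho> * cmod (z j) < t}" by blast
  qed measurable
  also have "\<dots> = (\<integral>\<^sup>+z. h (z j) \<partial>\<mu>)"
    by (intro nn_integral_eq_emeasure[symmetric]) (measurable, simp add: h_def indicator_def)
  also have "\<dots> = (\<integral>\<^sup>+z. h (\<Sum>k\<in>I. of_real (g k / \<rho>) * z k) \<partial>\<mu>)"
    using \<rho> False
    by (intro nn_integral_lincomb[symmetric] assms(1))
       (auto simp: power_divide norm_divide simp flip: sum_divide_distrib)
  also have "\<dots> = emeasure \<mu> {z\<in>space \<mu>. cmod (\<Sum>k\<in>I. of_real (g k) * z k) < t}"
  proof -
    have "\<rho> * cmod (\<Sum>k\<in>I. of_real (g k / \<rho>) * z k) = cmod (\<Sum>k\<in>I. of_real (g k) * z k)" for z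
      using \<rho>(1) by (simp add: norm_divide flip: sum_divide_distrib)
    then show ?thesis
      by (intro nn_integral_eq_emeasure) (measurable, simp add: h_def indicator_def)
  qed
  finally show ?thesis .
qed

text \<open>The measure of one event \<open>A\<close> on the product space is computed in both
  orders: integrating over \<open>z\<close> first gives at least three quarters of the desired
  probability, integrating over \<open>g\<close> first gives at most
  \<open>4 * \<eta>\<close>.\<close>

lemma prob_coord_less:
  assumes j: "j \<in> I" and "\<eta> > 0"
  shows "prob {z\<in>space \<mu>. cmod (z j) < \<eta> / sqrt (card I)} \<le> 6 * \<eta>"
proof -
  let ?G = "std_gaussian I"
  interpret G: prob_space ?G by (rule prob_space_std_gaussian)
  interpret P: pair_sigma_finite ?G \<mu> ..
  have I: "I \<noteq> {}" using j by auto
  define r where "r = real (card I)"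
  have r: "r > 0" using I finite_I by (simp add: r_def card_gt_0_iff)
  have coord: "(\<lambda>g. g k) \<in> borel_measurable ?G" if "k \<in> I" for k
    using std_gaussian_coord[OF that] by (simp add: distributed_def measurable_lborel1)
  have [measurable]: "(\<lambda>g. \<Sum>k\<in>I. (g k)\<^sup>2) \<in> borel_measurable ?G"
    by (intro borel_measurable_sum borel_measurable_power coord)
  define F where "F x = (\<Sum>k\<in>I. of_real (fst x k) * snd x k)" for x :: "('i \<Rightarrow> real) \<times> ('i \<Rightarrow> complex)"
  have of_real_coord: "(\<lambda>g. complex_of_real (g k)) \<in> borel_measurable ?G" if "k \<in> I" for k
    using coord[OF that] by simp
  have [measurable]: "F \<in> borel_measurable (?G \<Otimes>\<^sub>M \<mu>)"
    unfolding F_def by (intro borel_measurable_sum borel_measurable_times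
          measurable_compose[OF measurable_fst of_real_coord] measurable_compose[OF measurable_snd measurable_coord])
  \<comment> \<open>On \<open>B\<close> the norm of \<open>g\<close> is at most
    \<open>2 * sqrt r\<close>, so the threshold \<open>2 * \<eta>\<close> corresponds to
    \<open>\<eta> / sqrt r\<close> for a coordinate.\<close>
  define A where "A = {x\<in>space (?G \<Otimes>\<^sub>M \<mu>). cmod (F x) < 2 * \<eta>}"
  have A [measurable]: "A \<in> sets (?G \<Otimes>\<^sub>M \<mu>)" unfolding A_def by measurable
  define c where "c = emeasure \<mu> {z\<in>space \<mu>. cmod (z j) < \<eta> / sqrt r}"
  define B where "B = {g\<in>space ?G. (\<Sum>k\<in>I. (g k)\<^sup>2) \<le> 4 * r}"
  have B [measurable]: "B \<in> sets ?G" unfolding B_def by measurable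
  \<comment> \<open>for fixed \<open>g\<close> the combination is distributed as the norm of \<open>g\<close> times a coordinate,
    for fixed \<open>z\<close> it is Gaussian\<close>
  have "c * (3 / 4) \<le> c * emeasure ?G B"
    using std_gaussian_norm_sq_le[OF finite_I I] by (intro mult_left_mono) (auto simp: B_def r_def)
  also have "\<dots> = (\<integral>\<^sup>+g. c * indicator B g \<partial>?G)"
    by (rule nn_integral_cmult_indicator[OF B, symmetric])
  also have "\<dots> \<le> (\<integral>\<^sup>+g. \<integral>\<^sup>+z. indicator A (g, z) \<partial>\<mu> \<partial>?G)"
  proof (rule nn_integral_mono)
    fix g assume g: "g \<in> space ?G"
    note [measurable] = measurable_lincomb[of "\<lambda>k. of_real (g k)"]
    have "c \<le> emeasure \<mu> {z\<in>space \<mu>. cmod (\<Sum>k\<in>I. of_real (g k) * z k) < 2 * \<eta>}" if "g \<in> B"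
      using emeasure_real_lincomb_ge[OF j, of "2 * \<eta>" "2 * sqrt r" g] that r assms(2)
      by (simp add: c_def B_def power_mult_distrib)
    moreover have "(\<integral>\<^sup>+z. indicator A (g, z) \<partial>\<mu>) =
        emeasure \<mu> {z\<in>space \<mu>. cmod (\<Sum>k\<in>I. of_real (g k) * z k) < 2 * \<eta>}"
      using g by (intro nn_integral_eq_emeasure) (measurable, simp add: A_def F_def space_pair_measure indicator_def)
    ultimately show "c * indicator B g \<le> (\<integral>\<^sup>+z. indicator A (g, z) \<partial>\<mu>)"
      by (auto split: split_indicator)
  qed
  also have "\<dots> = (\<integral>\<^sup>+z. \<integral>\<^sup>+g. indicator A (g, z) \<partial>?G \<partial>\<mu>)"
    by (rule P.Fubini'[symmetric]) simp
  also have "\<dots> \<le> (\<integral>\<^sup>+z. ennreal (4 * \<eta>) \<partial>\<mu>)"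
  proof (rule nn_integral_mono)
    fix z assume z: "z \<in> space \<mu>"
    have [measurable]: "(\<lambda>g. \<Sum>k\<in>I. of_real (g k) * z k) \<in> borel_measurable ?G"
      by (intro borel_measurable_sum borel_measurable_times borel_measurable_const of_real_coord)
    have "(\<integral>\<^sup>+g. indicator A (g, z) \<partial>?G) =
        emeasure ?G {g\<in>space ?G. cmod (\<Sum>k\<in>I. of_real (g k) * z k) < 2 * \<eta>}"
      using z by (intro nn_integral_eq_emeasure) (measurable, simp add: A_def F_def space_pair_measure indicator_def)
    also have "\<dots> \<le> ennreal (4 * \<eta>)"
      using std_gaussian_lincomb_small_ball[OF finite_I, of z "2 * \<eta>"] z assms(2) by (simp add: space_eq)
    finally show "(\<integral>\<^sup>+g. indicator A (g, z) \<partial>?G) \<le> ennreal (4 * \<eta>)" .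
  qed
  also have "\<dots> = ennreal (4 * \<eta>)"
    by (simp add: emeasure_space_1)
  finally have "c * ennreal (3 / 4) \<le> ennreal (4 * \<eta>)"
    by (simp add: divide_ennreal[symmetric])
  \<comment> \<open>The resulting constant \<open>16 / 3\<close> is rounded up to
    \<open>6\<close>.\<close>
  then have "prob {z\<in>space \<mu>. cmod (z j) < \<eta> / sqrt r} * (3 / 4) \<le> 4 * \<eta>"
    using assms(2) by (simp add: c_def emeasure_eq_measure flip: ennreal_mult)
  then show ?thesis using assms(2) by (simp add: r_def)
qed

end


section \<open>Detection\<close>

text \<open>The received signal is the second, conjugate-linear argument of \<open>cinner\<close>,
  hence the conjugates on the attenuation coefficients.\<close>

lemma ambiguity_received:
  "ambiguity N S (received N r v S a w) p =
    (\<Sum>k = 1..r. cnj (a k) * cinner (Zmod N) (tf_shift N p S) (tf_shift N (v k) S)) +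
    cinner (Zmod N) (tf_shift N p S) w"
proof -
  let ?f = "tf_shift N p S"
  have "ambiguity N S (received N r v S a w) p =
      (\<Sum>n\<in>Zmod N. (\<Sum>k = 1..r. cnj (a k) * (?f n * cnj (tf_shift N (v k) S n))) + ?f n * cnj (w n))"
    unfolding ambiguity_def cinner_def
    by (intro sum.cong refl)
      (simp add: received_def tf_shift_def case_prod_unfold sum_distrib_left distrib_left mult_ac)
  also have "\<dots> = (\<Sum>n\<in>Zmod N. \<Sum>k = 1..r. cnj (a k) * (?f n * cnj (tf_shift N (v k) S n))) +
      cinner (Zmod N) ?f w"
    by (simp add: sum.distrib cinner_def)
  also have "(\<Sum>n\<in>Zmod N. \<Sum>k = 1..r. cnj (a k) * (?f n * cnj (tf_shift N (v k) S n))) =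
      (\<Sum>k = 1..r. cnj (a k) * cinner (Zmod N) ?f (tf_shift N (v k) S))"
    unfolding cinner_def sum_distrib_left by (rule sum.swap)
  finally show ?thesis .
qed

lemma measurable_into_restrict_PiM_component:
  assumes "X \<in> M \<rightarrow>\<^sub>M restrict_space (PiM I K) A" "k \<in> I"
  shows "(\<lambda>x. X x k) \<in> M \<rightarrow>\<^sub>M K k"
proof -
  have "X \<in> M \<rightarrow>\<^sub>M PiM I K"
    using assms(1) by (simp add: measurable_restrict_space2_iff)
  from measurable_compose[OF this measurable_component_singleton[OF assms(2)]] show ?thesis .
qed

section \<open>Error probabilities at a single point, for fixed \<open>N\<close>\<close>

locale target_detection = prob_space P for P :: "'w measure" +
  fixes N r :: nat and v :: "nat \<Rightarrow> int \<times> int" and S :: "int \<Rightarrow> complex"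
    and \<alpha> :: "'w \<Rightarrow> nat \<Rightarrow> complex" and W :: "'w \<Rightarrow> int \<Rightarrow> complex"
  assumes N: "N > 0" and r: "r \<ge> 1"
    and inj_v: "inj_on v {1..r}" and v: "v ` {1..r} \<subseteq> Vmod N"
    and S: "pseudo_random N 1 S"
    and \<alpha>: "\<alpha> \<in> P \<rightarrow>\<^sub>M csphere_borel {1..r}" and W: "W \<in> P \<rightarrow>\<^sub>M cvec_borel (Zmod N)"
    and uniform_\<alpha>: "uniform_on_csphere {1..r} (distr P (csphere_borel {1..r}) \<alpha>)"
begin

definition correlation :: "int \<times> int \<Rightarrow> 'w \<Rightarrow> complex" where
  "correlation p x = ambiguity N S (received N r v S (\<alpha> x) (W x)) p"

definition noise :: "int \<times> int \<Rightarrow> 'w \<Rightarrow> complex" where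
  "noise p x = cinner (Zmod N) (tf_shift N p S) (W x)"

text \<open>The entry of a target located at \<open>p\<close> itself is set to zero: every remaining
  entry is bounded through pseudo-randomness, and one notion of interference serves both target and
  non-target points.\<close>

definition cross :: "int \<times> int \<Rightarrow> nat \<Rightarrow> complex" where
  "cross p k = (if v k = p then 0 else cinner (Zmod N) (tf_shift N p S) (tf_shift N (v k) S))"

definition interference :: "int \<times> int \<Rightarrow> 'w \<Rightarrow> complex" where
  "interference p x = (\<Sum>k = 1..r. cnj (\<alpha> x k) * cross p k)"

lemma measurable_\<alpha> [measurable]: "k \<in> {1..r} \<Longrightarrow> (\<lambda>x. \<alpha> x k) \<in> borel_measurable P"
  by (rule measurable_into_restrict_PiM_component[OF \<alpha>])

lemma measurable_cnj_\<alpha>: "k \<in> {1..r} \<Longrightarrow> (\<lambda>x. cnj (\<alpha> x k)) \<in> borel_measurable P"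
  by (rule measurable_compose[OF measurable_\<alpha>]) (auto intro: borel_measurable_continuous_onI continuous_intros)

lemma measurable_noise [measurable]: "noise p \<in> borel_measurable P"
proof -
  have "(\<lambda>x. cnj (W x n)) \<in> borel_measurable P" if "n \<in> Zmod N" for n
    by (rule measurable_compose[OF measurable_compose[OF W measurable_component_singleton[OF that]]])
       (auto intro: borel_measurable_continuous_onI continuous_intros)
  then show ?thesis
    unfolding noise_def[abs_def] cinner_def
    by (intro borel_measurable_sum borel_measurable_times borel_measurable_const)
qed

lemma measurable_interference [measurable]: "interference p \<in> borel_measurable P"
  unfolding interference_def[abs_def]
  by (intro borel_measurable_sum borel_measurable_times borel_measurable_const measurable_cnj_\<alpha>)

lemma measurable_correlation [measurable]: "correlation p \<in> borel_measurable P"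
proof -
  have "(\<lambda>x. (\<Sum>k = 1..r. cnj (\<alpha> x k) * cinner (Zmod N) (tf_shift N p S) (tf_shift N (v k) S)) + noise p x)
      \<in> borel_measurable P"
    by (intro borel_measurable_add borel_measurable_sum borel_measurable_times borel_measurable_const
        measurable_cnj_\<alpha> measurable_noise)
  then show ?thesis
    unfolding correlation_def[abs_def] ambiguity_received noise_def .
qed

lemma correlation_off_target:
  assumes "p \<notin> v ` {1..r}"
  shows "correlation p x = interference p x + noise p x"
proof -
  have "cross p k = cinner (Zmod N) (tf_shift N p S) (tf_shift N (v k) S)" if "k \<in> {1..r}" for k
    using assms that by (auto simp: cross_def)
  then show ?thesis
    by (simp add: correlation_def ambiguity_received interference_def noise_def)
qed

text \<open>The norm-one shift at \<open>v j\<close> has inner product \<open>1\<close> with itself,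
  and injectivity of \<open>v\<close> makes \<open>j\<close> the only index omitted from the
  interference.\<close>

lemma correlation_target:
  assumes "j \<in> {1..r}"
  shows "correlation (v j) x = cnj (\<alpha> x j) + (interference (v j) x + noise (v j) x)"
proof -
  have self: "cinner (Zmod N) (tf_shift N (v j) S) (tf_shift N (v j) S) = 1"
    using S N by (intro cinner_self tf_shift_in_csphere) (auto simp: pseudo_random_def)
  have "(\<Sum>k = 1..r. cnj (\<alpha> x k) * cinner (Zmod N) (tf_shift N (v j) S) (tf_shift N (v k) S)) =
      (\<Sum>k = 1..r. (if k = j then cnj (\<alpha> x j) else 0) + cnj (\<alpha> x k) * cross (v j) k)"
  proof (rule sum.cong[OF refl])
    fix k assume "k \<in> {1..r}"
    then have "v k = v j \<longleftrightarrow> k = j"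
      using assms inj_v by (auto dest: inj_onD)
    then show "cnj (\<alpha> x k) * cinner (Zmod N) (tf_shift N (v j) S) (tf_shift N (v k) S) =
        (if k = j then cnj (\<alpha> x j) else 0) + cnj (\<alpha> x k) * cross (v j) k"
      by (simp add: cross_def self)
  qed
  also have "\<dots> = cnj (\<alpha> x j) + interference (v j) x"
    using assms by (simp add: sum.distrib interference_def)
  finally show ?thesis
    by (simp add: correlation_def ambiguity_received noise_def)
qed

text \<open>The \<open>r\<close> coefficients have squared moduli at most \<open>1 / N\<close>, so
  \<open>prob_lincomb_gt\<close> applies with \<open>B = sqrt (r / N)\<close>; the factor
  \<open>1 / sqrt r\<close> there removes the dependence on \<open>r\<close>.\<close>

lemma prob_interference_gt:
  assumes "p \<in> Vmod N" "s \<ge> 0"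
  shows "prob {x\<in>space P. cmod (interference p x) > s / sqrt N} \<le> 4 * exp (1 - s / 2)"
proof -
  let ?\<mu> = "distr P (csphere_borel {1..r}) \<alpha>"
  interpret U: uniform_csphere "{1..r}" ?\<mu>
    using uniform_\<alpha> by unfold_locales auto
  note [measurable] = U.measurable_lincomb[of "\<lambda>k. cnj (cross p k)"]
  have "cmod (cross p k) \<le> 1 / sqrt N" if "k \<in> {1..r}" for k
    using pseudo_random_cross_bound[OF N S assms(1), of "v k"] subsetD[OF v imageI[OF that]]
    by (auto simp: cross_def)
  then have "(cmod (cnj (cross p k)))\<^sup>2 \<le> 1 / N" if "k \<in> {1..r}" for k
    using power_mono[of "cmod (cross p k)" "1 / sqrt N" 2] that by (simp add: power_divide)
  then have "(\<Sum>k = 1..r. (cmod (cnj (cross p k)))\<^sup>2) \<le> (\<Sum>k = 1..r. 1 / real N)"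
    by (rule sum_mono)
  also have "\<dots> = (sqrt (r / N))\<^sup>2"
    by simp
  finally have bound: "U.prob {z\<in>space ?\<mu>. cmod (\<Sum>k = 1..r. cnj (cross p k) * z k) > sqrt (r / N) * s / sqrt r}
      \<le> 4 * exp (1 - s / 2)"
    using r N assms(2) U.prob_lincomb_gt[of "sqrt (r / N)" s "\<lambda>k. cnj (cross p k)"] by simp
  have eq: "sqrt (r / N) * s / sqrt r = s / sqrt N"
    using r by (simp add: real_sqrt_divide)
  have "U.prob {z\<in>space ?\<mu>. cmod (\<Sum>k = 1..r. cnj (cross p k) * z k) > s / sqrt N} =
      prob (\<alpha> -` {z\<in>space ?\<mu>. cmod (\<Sum>k = 1..r. cnj (cross p k) * z k) > s / sqrt N} \<inter> space P)"
    by (rule measure_distr[OF \<alpha>]) (unfold U.sets_eq[symmetric], measurable)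
  also have "\<alpha> -` {z\<in>space ?\<mu>. cmod (\<Sum>k = 1..r. cnj (cross p k) * z k) > s / sqrt N} \<inter> space P =
      {x\<in>space P. cmod (interference p x) > s / sqrt N}"
  proof -
    \<comment> \<open>Conjugation preserves the modulus and turns the interference into a form
      linear in \<open>\<alpha>\<close>.\<close>
    have "cmod (interference p x) = cmod (\<Sum>k = 1..r. cnj (cross p k) * \<alpha> x k)" for x
      unfolding interference_def
      by (subst complex_mod_cnj[symmetric]) (simp add: mult.commute)
    then show ?thesis
      using measurable_space[OF \<alpha>] by auto
  qed
  finally show ?thesis using bound unfolding eq by simp
qed

lemma prob_attenuation_less:
  assumes "j \<in> {1..r}" "\<eta> > 0"
  shows "prob {x\<in>space P. cmod (\<alpha> x j) < \<eta> / sqrt r} \<le> 6 * \<eta>"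
proof -
  let ?\<mu> = "distr P (csphere_borel {1..r}) \<alpha>"
  interpret U: uniform_csphere "{1..r}" ?\<mu>
    using uniform_\<alpha> by unfold_locales auto
  note [measurable] = U.measurable_coord[OF assms(1)]
  have "U.prob {z\<in>space ?\<mu>. cmod (z j) < \<eta> / sqrt r} =
      prob (\<alpha> -` {z\<in>space ?\<mu>. cmod (z j) < \<eta> / sqrt r} \<inter> space P)"
    by (rule measure_distr[OF \<alpha>]) (unfold U.sets_eq[symmetric], measurable)
  also have "\<alpha> -` {z\<in>space ?\<mu>. cmod (z j) < \<eta> / sqrt r} \<inter> space P =
      {x\<in>space P. cmod (\<alpha> x j) < \<eta> / sqrt r}"
    using measurable_space[OF \<alpha>] by auto
  finally show ?thesis
    using U.prob_coord_less[OF assms] by simp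
qed

lemma prob_disturbance_gt:
  assumes "p \<in> Vmod N" "s \<ge> 0"
  shows "prob {x\<in>space P. cmod (interference p x + noise p x) > s / sqrt N + b} \<le>
    4 * exp (1 - s / 2) + prob {x\<in>space P. cmod (noise p x) > b}"
proof -
  have "prob {x\<in>space P. cmod (interference p x + noise p x) > s / sqrt N + b} \<le>
      prob ({x\<in>space P. cmod (interference p x) > s / sqrt N} \<union> {x\<in>space P. cmod (noise p x) > b})"
  proof (rule finite_measure_mono)
    have "cmod (interference p x) > s / sqrt N \<or> cmod (noise p x) > b"
      if "cmod (interference p x + noise p x) > s / sqrt N + b" for x
      using that norm_triangle_ineq[of "interference p x" "noise p x"] by linarith
    then show "{x\<in>space P. cmod (interference p x + noise p x) > s / sqrt N + b} \<subseteq>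
        {x\<in>space P. cmod (interference p x) > s / sqrt N} \<union> {x\<in>space P. cmod (noise p x) > b}"
      by blast
  qed measurable
  also have "\<dots> \<le> prob {x\<in>space P. cmod (interference p x) > s / sqrt N} + prob {x\<in>space P. cmod (noise p x) > b}"
    by (rule measure_Un_le) measurable
  finally show ?thesis
    using prob_interference_gt[OF assms] by linarith
qed

lemma prob_false_alarm:
  assumes "p \<in> Vmod N - v ` {1..r}" "s \<ge> 0" "s / sqrt N + b < t"
  shows "prob {x\<in>space P. t \<le> cmod (correlation p x)} \<le>
    4 * exp (1 - s / 2) + prob {x\<in>space P. cmod (noise p x) > b}"
proof -
  have "prob {x\<in>space P. t \<le> cmod (correlation p x)} \<le>
      prob {x\<in>space P. cmod (interference p x + noise p x) > s / sqrt N + b}"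
    using assms by (intro finite_measure_mono) (auto simp: correlation_off_target, measurable)
  also have "\<dots> \<le> 4 * exp (1 - s / 2) + prob {x\<in>space P. cmod (noise p x) > b}"
    using assms by (intro prob_disturbance_gt) auto
  finally show ?thesis .
qed

text \<open>By the reverse triangle inequality, a miss forces either a small attenuation coefficient
  or a large disturbance.\<close>

lemma prob_missed:
  assumes j: "j \<in> {1..r}" and "s \<ge> 0" "\<eta> > 0" "t + (s / sqrt N + b) \<le> \<eta> / sqrt r"
  shows "prob {x\<in>space P. \<not> t \<le> cmod (correlation (v j) x)} \<le>
    6 * \<eta> + 4 * exp (1 - s / 2) + prob {x\<in>space P. cmod (noise (v j) x) > b}"
proof -
  let ?d = "\<lambda>x. interference (v j) x + noise (v j) x"
  note [measurable] = measurable_\<alpha>[OF j]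
  have "prob {x\<in>space P. \<not> t \<le> cmod (correlation (v j) x)} \<le>
      prob ({x\<in>space P. cmod (\<alpha> x j) < \<eta> / sqrt r} \<union> {x\<in>space P. cmod (?d x) > s / sqrt N + b})"
  proof (rule finite_measure_mono)
    have "cmod (\<alpha> x j) < \<eta> / sqrt r \<or> cmod (?d x) > s / sqrt N + b"
      if "\<not> t \<le> cmod (correlation (v j) x)" for x
      using that assms(4) norm_diff_ineq[of "cnj (\<alpha> x j)" "?d x"]
      unfolding correlation_target[OF j] complex_mod_cnj by linarith
    then show "{x\<in>space P. \<not> t \<le> cmod (correlation (v j) x)} \<subseteq>
        {x\<in>space P. cmod (\<alpha> x j) < \<eta> / sqrt r} \<union> {x\<in>space P. cmod (?d x) > s / sqrt N + b}"
      by blast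
  qed measurable
  also have "\<dots> \<le> prob {x\<in>space P. cmod (\<alpha> x j) < \<eta> / sqrt r} + prob {x\<in>space P. cmod (?d x) > s / sqrt N + b}"
    by (rule measure_Un_le) measurable
  finally show ?thesis
    using prob_attenuation_less[OF j assms(3)] prob_disturbance_gt[of "v j" s b] j v assms(2)
    by (auto simp: image_subset_iff)
qed

section \<open>From pointwise probabilities to the two performance measures\<close>

lemma expectation_card_detected:
  assumes "T \<subseteq> Vmod N"
  shows "(\<integral>x. real (card (PR_method N \<delta>' S (received N r v S (\<alpha> x) (W x)) \<inter> T)) \<partial>P) =
    (\<Sum>p\<in>T. prob {x\<in>space P. real N powr (- 1 / 2 + \<delta>') \<le> cmod (correlation p x)})"
proof -
  define E where "E p = {x\<in>space P. real N powr (- 1 / 2 + \<delta>') \<le> cmod (correlation p x)}" for p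
  have T: "finite T" using assms finite_Vmod by (rule finite_subset)
  have E: "E p \<in> events" for p unfolding E_def by measurable
  have "real (card (PR_method N \<delta>' S (received N r v S (\<alpha> x) (W x)) \<inter> T)) = (\<Sum>p\<in>T. indicator (E p) x)"
    if "x \<in> space P" for x
  proof -
    have "PR_method N \<delta>' S (received N r v S (\<alpha> x) (W x)) \<inter> T = {p\<in>T. x \<in> E p}"
      using assms that by (auto simp: PR_method_def E_def correlation_def)
    then show ?thesis using T by (simp add: indicator_def sum.If_cases Int_def)
  qed
  then have "(\<integral>x. real (card (PR_method N \<delta>' S (received N r v S (\<alpha> x) (W x)) \<inter> T)) \<partial>P) =
      (\<integral>x. (\<Sum>p\<in>T. indicator (E p) x) \<partial>P)"
    by (rule Bochner_Integration.integral_cong[OF refl])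
  also have "\<dots> = (\<Sum>p\<in>T. \<integral>x. indicator (E p) x \<partial>P)"
    using E by (intro Bochner_Integration.integral_sum) (simp add: emeasure_eq_measure)
  also have "\<dots> = (\<Sum>p\<in>T. prob (E p))"
    using E by simp
  finally show ?thesis by (simp only: E_def)
qed

lemma expected_false_targets_bounds:
  assumes "s \<ge> 0" "s / sqrt N + b < real N powr (- 1 / 2 + \<delta>')"
    and noise: "\<And>p. p \<in> Vmod N \<Longrightarrow> prob {x\<in>space P. cmod (noise p x) > b} \<le> q"
  shows "expected_false_targets N \<delta>' r v S P (\<lambda>x. received N r v S (\<alpha> x) (W x))
    \<in> {0..(real N)\<^sup>2 * (4 * exp (1 - s / 2) + q)}"
proof -
  let ?T = "Vmod N - v ` {1..r}"
  let ?E = "\<lambda>p. {x\<in>space P. real N powr (- 1 / 2 + \<delta>') \<le> cmod (correlation p x)}"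
  have E: "expected_false_targets N \<delta>' r v S P (\<lambda>x. received N r v S (\<alpha> x) (W x)) = (\<Sum>p\<in>?T. prob (?E p))"
    unfolding expected_false_targets_def by (rule expectation_card_detected) auto
  have "prob (?E p) \<le> 4 * exp (1 - s / 2) + q" if "p \<in> ?T" for p
    using prob_false_alarm[OF that assms(1,2)] noise[of p] that by auto
  then have "(\<Sum>p\<in>?T. prob (?E p)) \<le> (\<Sum>p\<in>?T. 4 * exp (1 - s / 2) + q)"
    by (rule sum_mono)
  \<comment> \<open>Summing over all of \<open>Vmod N\<close> gives the count
    \<open>N\<^sup>2\<close>; the added terms are nonnegative because \<open>q\<close> bounds a
    probability.\<close>
  also have "\<dots> \<le> (\<Sum>p\<in>Vmod N. 4 * exp (1 - s / 2) + q)"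
  proof (rule sum_mono2)
    fix p assume "p \<in> Vmod N - ?T"
    then have "0 \<le> q" using noise[of p] measure_nonneg[of P] order_trans by blast
    then show "0 \<le> 4 * exp (1 - s / 2) + q" by simp
  qed auto
  also have "\<dots> = (real N)\<^sup>2 * (4 * exp (1 - s / 2) + q)"
    by (simp add: card_Vmod)
  finally show ?thesis
    using E by (auto intro: sum_nonneg)
qed

lemma detection_prob_bounds:
  assumes "s \<ge> 0" "\<eta> > 0" "real N powr (- 1 / 2 + \<delta>') + (s / sqrt N + b) \<le> \<eta> / sqrt r"
    and noise: "\<And>p. p \<in> Vmod N \<Longrightarrow> prob {x\<in>space P. cmod (noise p x) > b} \<le> q"
  shows "detection_prob N \<delta>' r v S P (\<lambda>x. received N r v S (\<alpha> x) (W x))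
    \<in> {1 - (6 * \<eta> + 4 * exp (1 - s / 2) + q)..1}"
proof -
  let ?E = "\<lambda>p. {x\<in>space P. real N powr (- 1 / 2 + \<delta>') \<le> cmod (correlation p x)}"
  \<comment> \<open>Detected targets are counted as points; injectivity of \<open>v\<close> turns
    this into a sum over the \<open>r\<close> indices.\<close>
  have D: "detection_prob N \<delta>' r v S P (\<lambda>x. received N r v S (\<alpha> x) (W x)) =
      (\<Sum>j = 1..r. prob (?E (v j))) / r"
    unfolding detection_prob_def expectation_card_detected[OF v] sum.reindex[OF inj_v] by simp
  have lower: "1 - (6 * \<eta> + 4 * exp (1 - s / 2) + q) \<le> prob (?E (v j))" if j: "j \<in> {1..r}" for j
  proof -
    have "prob {x\<in>space P. \<not> real N powr (- 1 / 2 + \<delta>') \<le> cmod (correlation (v j) x)} = 1 - prob (?E (v j))"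
      by (rule prob_neg) measurable
    moreover have "v j \<in> Vmod N" using v j by auto
    ultimately show ?thesis
      using prob_missed[OF j assms(1-3)] noise[of "v j"] by linarith
  qed
  have "(\<Sum>j = 1..r. 1 - (6 * \<eta> + 4 * exp (1 - s / 2) + q)) \<le> (\<Sum>j = 1..r. prob (?E (v j)))"
    by (rule sum_mono[OF lower])
  moreover have "(\<Sum>j = 1..r. prob (?E (v j))) \<le> (\<Sum>j = 1..r. 1)"
    by (rule sum_mono) simp
  ultimately show ?thesis
    unfolding D using r by (simp add: pos_le_divide_eq pos_divide_le_eq mult.commute)
qed

end

section \<open>Choice of parameters and passage to the limit\<close>

theorem mainTheorem1:
  fixes \<delta> :: real
    and \<M> :: "nat set"
    and r :: "nat \<Rightarrow> nat"
    and v :: "nat \<Rightarrow> nat \<Rightarrow> int \<times> int"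
    and S :: "nat \<Rightarrow> int \<Rightarrow> complex"
    and P :: "nat \<Rightarrow> 'w measure"
    and \<alpha> :: "nat \<Rightarrow> 'w \<Rightarrow> nat \<Rightarrow> complex"
    and W :: "nat \<Rightarrow> 'w \<Rightarrow> int \<Rightarrow> complex"
  assumes "\<delta> > 0"
    and "infinite \<M>"
    and "\<And>N. N \<in> \<M> \<Longrightarrow> N > 0"
    and "\<And>N. N \<in> \<M> \<Longrightarrow> 1 \<le> r N \<and> real (r N) \<le> real N powr (1 - \<delta>)"
    and "\<And>N. N \<in> \<M> \<Longrightarrow> inj_on (v N) {1..r N} \<and> v N ` {1..r N} \<subseteq> Vmod N"
    and "\<And>N. N \<in> \<M> \<Longrightarrow> pseudo_random N 1 (S N)"
    and "\<And>N. N \<in> \<M> \<Longrightarrow> prob_space (P N)"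
    and "\<And>N. N \<in> \<M> \<Longrightarrow> \<alpha> N \<in> measurable (P N) (csphere_borel {1..r N})"
    and "\<And>N. N \<in> \<M> \<Longrightarrow> W N \<in> measurable (P N) (cvec_borel (Zmod N))"
    and uniformity:
      "\<And>N. N \<in> \<M> \<Longrightarrow>
         uniform_on_csphere {1..r N} (distr (P N) (csphere_borel {1..r N}) (\<alpha> N))"
    and cancellation: "square_root_cancellation \<M> P W"
    and independence:
      "\<And>N. N \<in> \<M> \<Longrightarrow>
         indep_rv (P N) (cvec_borel (Zmod N)) (W N) (csphere_borel {1..r N}) (\<alpha> N)"
  shows "((\<lambda>N. detection_prob N (\<delta> / 4) (r N) (v N) (S N) (P N)
            (\<lambda>x. received N (r N) (v N) (S N) (\<alpha> N x) (W N x))) \<longlongrightarrow> 1)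
           (inf sequentially (principal \<M>)) \<and>
         ((\<lambda>N. expected_false_targets N (\<delta> / 4) (r N) (v N) (S N) (P N)
            (\<lambda>x. received N (r N) (v N) (S N) (\<alpha> N x) (W N x))) \<longlongrightarrow> 0)
           (inf sequentially (principal \<M>))"
proof -
  \<comment> \<open>\<open>b\<close> is the noise level from cancellation with exponent
    \<open>\<delta> / 8\<close>, and \<open>s\<close> is chosen so that the interference level
    \<open>s N / sqrt N\<close> equals \<open>b N\<close>. \<open>\<eta>\<close> makes
    \<open>\<eta> N / sqrt (r N)\<close> at least twice the detection threshold when
    \<open>r N \<le> N powr (1 - \<delta>)\<close>.\<close>
  define b where "b N = real N powr (- 1 / 2 + \<delta> / 8)" for N
  define s where "s N = real N powr (\<delta> / 8)" for N
  define \<eta> where "\<eta> N = 2 * real N powr (- \<delta> / 4)" for N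
  have "\<delta> / 8 > 0"
    using assms(1) by simp
  with cancellation obtain c where c: "c > 0" and noise: "\<forall>N\<in>\<M>. \<forall>u :: nat \<Rightarrow> int \<Rightarrow> complex.
      (\<forall>j\<in>{1..N\<^sup>2}. u j \<in> csphere (Zmod N)) \<longrightarrow>
      measure (P N) {x \<in> space (P N). \<forall>j\<in>{1..N\<^sup>2}. cmod (cinner (Zmod N) (W N x) (u j)) \<le> b N}
        \<ge> 1 - exp (- c * real N)"
    unfolding square_root_cancellation_def b_def by blast
  have target: "target_detection (P N) N (r N) (v N) (S N) (\<alpha> N) (W N)" if "N \<in> \<M>" for N
    unfolding target_detection_def target_detection_axioms_def using assms that by auto
  have noise_gt: "measure (P N) {x\<in>space (P N). cmod (target_detection.noise N (S N) (W N) p x) > b N}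
      \<le> exp (- c * real N)" if "N \<in> \<M>" for N p
  proof -
    interpret target_detection "P N" N "r N" "v N" "S N" "\<alpha> N" "W N"
      by (rule target[OF that])
    have "tf_shift N p (S N) \<in> csphere (Zmod N)"
      using S N by (intro tf_shift_in_csphere) (auto simp: pseudo_random_def)
    moreover have "cmod (cinner (Zmod N) (W N x) (tf_shift N p (S N))) = cmod (noise p x)" for x
      unfolding noise_def by (subst cinner_commute) simp
    \<comment> \<open>Cancellation is applied to a constant family of vectors; as its index set is
      nonempty, the simultaneous bound reduces to a single inequality.\<close>
    moreover have "\<exists>j\<ge>Suc 0. j \<le> N\<^sup>2"
      using N by (intro exI[of _ 1]) (simp add: Suc_le_eq)
    ultimately have "prob {x\<in>space (P N). cmod (noise p x) \<le> b N} \<ge> 1 - exp (- c * real N)"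
      using noise[rule_format, OF that, of "\<lambda>_. tf_shift N p (S N)"] by simp
    moreover have "prob {x\<in>space (P N). \<not> cmod (noise p x) \<le> b N} =
        1 - prob {x\<in>space (P N). cmod (noise p x) \<le> b N}"
      by (rule prob_neg) measurable
    ultimately show ?thesis by (simp add: not_le)
  qed
  have s_div: "s N / sqrt N = b N" if "N \<in> \<M>" for N
    using assms(3)[OF that] by (simp add: s_def b_def powr_half_sqrt[symmetric] powr_diff[symmetric])
  \<comment> \<open>The threshold is \<open>s N * b N\<close>, so \<open>s N > 2\<close> leaves room
    for interference and noise together.\<close>
  have bound: "b N + b N < real N powr (- 1 / 2 + \<delta> / 4)" if "N \<in> \<M>" "s N > 2" for N
  proof -
    have "b N + b N = 2 * b N" by simp
    also have "\<dots> < s N * b N"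
      using that assms(3)[OF that(1)] by (intro mult_strict_right_mono) (auto simp: b_def)
    also have "\<dots> = real N powr (- 1 / 2 + \<delta> / 4)"
      by (simp add: s_def b_def flip: powr_add)
    finally show ?thesis .
  qed
  have attenuation: "2 * real N powr (- 1 / 2 + \<delta> / 4) \<le> \<eta> N / sqrt (r N)" if "N \<in> \<M>" for N
  proof -
    have N: "N > 0" and r: "r N \<ge> 1" "real (r N) \<le> real N powr (1 - \<delta>)"
      using assms(3,4)[OF that] by auto
    have "sqrt (r N) \<le> sqrt (real N powr (1 - \<delta>))"
      using r by simp
    also have "\<dots> = real N powr ((1 - \<delta>) / 2)"
      using N by (simp add: powr_half_sqrt[symmetric] powr_powr)
    finally have "2 * real N powr (- 1 / 2 + \<delta> / 4) * sqrt (r N) \<le>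
        2 * real N powr (- 1 / 2 + \<delta> / 4) * real N powr ((1 - \<delta>) / 2)"
      by (intro mult_left_mono) auto
    also have "\<dots> = \<eta> N"
      by (simp add: \<eta>_def mult.assoc flip: powr_add) (simp add: field_simps)
    finally show ?thesis
      using r by (simp add: pos_le_divide_eq)
  qed
  have large: "eventually (\<lambda>N. N \<in> \<M> \<and> s N > 2) (inf sequentially (principal \<M>))"
  proof -
    have "eventually (\<lambda>N::nat. real N powr (\<delta> / 8) > 2) sequentially"
      using assms(1) by real_asymp
    then show ?thesis
      unfolding eventually_inf_principal s_def by eventually_elim auto
  qed
  have FT: "eventually (\<lambda>N. expected_false_targets N (\<delta> / 4) (r N) (v N) (S N) (P N)
        (\<lambda>x. received N (r N) (v N) (S N) (\<alpha> N x) (W N x))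
      \<in> {0..(real N)\<^sup>2 * (4 * exp (1 - s N / 2) + exp (- c * real N))}) (inf sequentially (principal \<M>))"
    using large
  proof eventually_elim
    case (elim N)
    interpret target_detection "P N" N "r N" "v N" "S N" "\<alpha> N" "W N"
      using elim by (intro target) auto
    show ?case
      using elim bound[of N] by (intro expected_false_targets_bounds[of _ "b N"] noise_gt) (auto simp: s_div)
  qed
  have D: "eventually (\<lambda>N. detection_prob N (\<delta> / 4) (r N) (v N) (S N) (P N)
        (\<lambda>x. received N (r N) (v N) (S N) (\<alpha> N x) (W N x))
      \<in> {1 - (6 * \<eta> N + 4 * exp (1 - s N / 2) + exp (- c * real N))..1}) (inf sequentially (principal \<M>))"
    using large
  proof eventually_elim
    case (elim N)
    interpret target_detection "P N" N "r N" "v N" "S N" "\<alpha> N" "W N"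
      using elim by (intro target) auto
    \<comment> \<open>The disturbance is below one threshold, so the left side is below two
      thresholds, which \<open>attenuation\<close> covers.\<close>
    have "real N powr (- 1 / 2 + \<delta> / 4) + (s N / sqrt N + b N) \<le> \<eta> N / sqrt (r N)"
      using elim bound[of N] attenuation[of N] by (simp add: s_div)
    moreover have "s N \<ge> 0" "\<eta> N > 0"
      using N by (auto simp: s_def \<eta>_def)
    ultimately show ?case
      using elim by (intro detection_prob_bounds[of _ _ _ "b N"] noise_gt) auto
  qed
  \<comment> \<open>Limits over all \<open>N\<close> pass to the restriction to
    \<open>\<M>\<close>.\<close>
  have le: "inf sequentially (principal \<M>) \<le> sequentially"
    by simp
  \<comment> \<open>The stretched exponential in \<open>N powr (\<delta> / 8)\<close> outweighs the
    factor \<open>N\<^sup>2\<close> from the union over all points.\<close>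
  have lim_cross: "((\<lambda>N::nat. (real N)\<^sup>2 * (4 * exp (1 - real N powr (\<delta> / 8) / 2))) \<longlongrightarrow> 0) sequentially"
      "((\<lambda>N::nat. 4 * exp (1 - real N powr (\<delta> / 8) / 2)) \<longlongrightarrow> 0) sequentially"
    using assms(1) by real_asymp+
  have lim_noise: "((\<lambda>N::nat. (real N)\<^sup>2 * exp (- c * real N)) \<longlongrightarrow> 0) sequentially"
      "((\<lambda>N::nat. exp (- c * real N)) \<longlongrightarrow> 0) sequentially"
    using c by real_asymp+
  have lim_\<eta>: "((\<lambda>N::nat. 6 * (2 * real N powr (- \<delta> / 4))) \<longlongrightarrow> 0) sequentially"
    using assms(1) by real_asymp
  have lim_FT: "((\<lambda>N. (real N)\<^sup>2 * (4 * exp (1 - s N / 2) + exp (- c * real N))) \<longlongrightarrow> 0)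
      (inf sequentially (principal \<M>))"
    unfolding s_def distrib_left[of "(real _)\<^sup>2"]
    by (rule tendsto_mono[OF le], rule tendsto_add_zero) (rule lim_cross lim_noise)+
  have "((\<lambda>N. 1 - (6 * \<eta> N + 4 * exp (1 - s N / 2) + exp (- c * real N))) \<longlongrightarrow> 1 - 0)
      (inf sequentially (principal \<M>))"
    unfolding s_def \<eta>_def
    by (rule tendsto_mono[OF le], intro tendsto_diff tendsto_const tendsto_add_zero lim_\<eta> lim_cross lim_noise)
  then have lim_D: "((\<lambda>N. 1 - (6 * \<eta> N + 4 * exp (1 - s N / 2) + exp (- c * real N))) \<longlongrightarrow> 1)
      (inf sequentially (principal \<M>))"
    by simp
  show ?thesis
  proof
    show "((\<lambda>N. detection_prob N (\<delta> / 4) (r N) (v N) (S N) (P N)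
        (\<lambda>x. received N (r N) (v N) (S N) (\<alpha> N x) (W N x))) \<longlongrightarrow> 1) (inf sequentially (principal \<M>))"
      using D by (intro tendsto_sandwich[OF _ _ lim_D tendsto_const]) (auto elim: eventually_mono)
    show "((\<lambda>N. expected_false_targets N (\<delta> / 4) (r N) (v N) (S N) (P N)
        (\<lambda>x. received N (r N) (v N) (S N) (\<alpha> N x) (W N x))) \<longlongrightarrow> 0) (inf sequentially (principal \<M>))"
      using FT by (intro tendsto_sandwich[OF _ _ tendsto_const lim_FT]) (auto elim: eventually_mono)
  qed
qed

end
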